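(* Let $\alpha\in(0,1)$ and $\beta\in(0,1]$ satisfy $\alpha\beta>\frac12$, let $B^{\alpha,\beta}=(B^{\alpha,\beta}(t))_{t\in[0,1]}$ be a bifractional Brownian motion with parameters $\alpha,\beta$, and let $(\varphi_n)_{n\ge1}$ be an orthonormal basis of the associated Hilbert space $\mathcal{H}$. Then, almost surely, $$\sum_{n=1}^{N}\langle\varphi_n,\mathbf{1}_{[0,t]}\rangle_{\mathcal{H}}\,B^{\alpha,\beta}(\varphi_n)\ \underset{N\to+\infty}{\longrightarrow}\ B^{\alpha,\beta}(t)\qquad\text{in the H\"older space }\mathcal{C}^{\gamma},$$ for any $0<\gamma<\alpha\beta$; i.e. the partial sums, viewed as functions of $t\in[0,1]$, converge to the sample path $t\mapsto B^{\alpha,\beta}(t)$ in the norm of $\mathcal{C}^\gamma$.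
   Context: Bifractional Brownian motion with parameters $\alpha\in(0,1)$, $\beta\in(0,1]$: a centred real-valued Gaussian process $(B^{\alpha,\beta}(t))_{t\in[0,1]}$, with continuous sample paths, whose covariance function is $$R(s,t)=\frac{1}{2^\beta}\left((t^{2\alpha}+s^{2\alpha})^\beta-|t-s|^{2\alpha\beta}\right).$$ The Hilbert space $\mathcal{H}$ and the Wiener integral: let $\mathcal{E}$ be the linear space generated by the indicator functions $\mathbf{1}_{[0,t]}$, $t\in[0,1]$, endowed with the inner product determined by $\langle\mathbf{1}_{[0,t]},\mathbf{1}_{[0,s]}\rangle_{\mathcal{H}}=R(s,t)$, $s,t\in[0,1]$. $\mathcal{H}$ is the completion of $\mathcal{E}$ with respect to this inner product. The map $\varphi\mapsto B^{\alpha,\beta}(\varphi)$ is the linear isometry from $\mathcal{H}$ onto the Gaussian space generated by $B^{\alpha,\beta}$ (the closed linear span of $\{B^{\alpha,\beta}(t)\}$ in $L^2(\mathbb{P})$) that extends $\mathbf{1}_{[0,t]}\mapsto B^{\alpha,\beta}(t)$; $B^{\alpha,\beta}(\varphi)$ is called the Wiener integral of $\varphi$ with respect to $B^{\alpha,\beta}$. H\"older space on $I=[0,1]$: $\mathcal{C}^\gamma$ is the space of continuous $f:I\to\mathbb{R}$ with $\sup_{x\ne y\in I}\frac{|f(x)-f(y)|}{|x-y|^\gamma}<\infty$, with norm $\|f\|_\gamma=\sup_{x\in I}|f(x)|+\sup_{x\ne y\in I}\frac{|f(x)-f(y)|}{|x-y|^\gamma}$. *)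

theory Defs
  imports "HOL-Probability.Probability"
begin

section \<open>Bifractional Brownian motion on the unit interval\<close>

definition bifractional_cov :: "real \<Rightarrow> real \<Rightarrow> real \<Rightarrow> real \<Rightarrow> real" where
  "bifractional_cov \<alpha> \<beta> s t =
     1 / 2 powr \<beta> *
       ((t powr (2 * \<alpha>) + s powr (2 * \<alpha>)) powr \<beta> - \<bar>t - s\<bar> powr (2 * \<alpha> * \<beta>))"

text \<open>Degenerate (almost surely constant) variables count as Gaussian; this is needed
  because \<open>B 0\<close> has variance \<open>0\<close>.\<close>

definition gaussian_rv :: "'w measure \<Rightarrow> ('w \<Rightarrow> real) \<Rightarrow> bool" where
  "gaussian_rv M X \<longleftrightarrow>
     X \<in> borel_measurable M \<and>
     (\<exists>\<mu>. (AE \<omega> in M. X \<omega> = \<mu>) \<or>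
          (\<exists>\<sigma>>0. distributed M lborel X (normal_density \<mu> \<sigma>)))"

definition gaussian_process_on :: "'w measure \<Rightarrow> real set \<Rightarrow> (real \<Rightarrow> 'w \<Rightarrow> real) \<Rightarrow> bool" where
  "gaussian_process_on M I B \<longleftrightarrow>
     (\<forall>T c. finite T \<longrightarrow> T \<subseteq> I \<longrightarrow> gaussian_rv M (\<lambda>\<omega>. \<Sum>t\<in>T. c t * B t \<omega>))"

definition cov :: "'w measure \<Rightarrow> ('w \<Rightarrow> real) \<Rightarrow> ('w \<Rightarrow> real) \<Rightarrow> real" where
  "cov M X Y =
     integral\<^sup>L M (\<lambda>\<omega>. (X \<omega> - integral\<^sup>L M X) * (Y \<omega> - integral\<^sup>L M Y))"

text \<open>Only the values \<open>B t\<close> with \<open>t\<close> in the unit interval are constrained.\<close>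

definition bifractional_BM ::
    "'w measure \<Rightarrow> real \<Rightarrow> real \<Rightarrow> (real \<Rightarrow> 'w \<Rightarrow> real) \<Rightarrow> bool" where
  "bifractional_BM M \<alpha> \<beta> B \<longleftrightarrow>
     prob_space M \<and>
     gaussian_process_on M {0..1} B \<and>
     (\<forall>t\<in>{0..1}. integral\<^sup>L M (B t) = 0) \<and>
     (\<forall>s\<in>{0..1}. \<forall>t\<in>{0..1}. cov M (B s) (B t) = bifractional_cov \<alpha> \<beta> s t) \<and>
     (\<forall>\<omega>\<in>space M. continuous_on {0..1} (\<lambda>t. B t \<omega>))"


section \<open>The Hilbert space and the Wiener integral\<close>

definition step_space :: "(real \<Rightarrow> real) set" where
  "step_space =
     {(\<lambda>x. \<Sum>t\<in>T. c t * indicator {0..t} x) | T c. finite T \<and> T \<subseteq> {0..1}}"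

text \<open>
  The Hilbert space depends on the parameters \<open>\<alpha>, \<beta>\<close>, so it cannot be a fixed type.
  It is presented as an arbitrary completion: a complete inner product space \<open>'h\<close>
  with a linear map \<open>\<iota>\<close> from the step functions onto a dense subspace of \<open>'h\<close> that
  transports the inner product. By bilinearity the inner product is determined by its values
  on the indicators. It is only positive semidefinite on \<open>step_space\<close>, since
  \<open>R(0,0) = 0\<close> although the indicator of \<open>{0}\<close> is not the zero function, so
  \<open>\<iota>\<close> is not required to be injective: the null vectors are sent to \<open>0\<close>.
  A completion is unique up to isometric isomorphism.
\<close>

definition is_completion ::
    "real \<Rightarrow> real \<Rightarrow> ((real \<Rightarrow> real) \<Rightarrow> 'h::{real_inner, complete_space}) \<Rightarrow> bool" where
  "is_completion \<alpha> \<beta> \<iota> \<longleftrightarrow>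
     (\<forall>f\<in>step_space. \<forall>g\<in>step_space. \<forall>a b.
        \<iota> (\<lambda>x. a * f x + b * g x) = a *\<^sub>R \<iota> f + b *\<^sub>R \<iota> g) \<and>
     (\<forall>s\<in>{0..1}. \<forall>t\<in>{0..1}.
        inner (\<iota> (indicator {0..t})) (\<iota> (indicator {0..s})) = bifractional_cov \<alpha> \<beta> s t) \<and>
     closure (\<iota> ` step_space) = UNIV"

definition L2 :: "'w measure \<Rightarrow> ('w \<Rightarrow> real) set" where
  "L2 M = {X \<in> borel_measurable M. integrable M (\<lambda>\<omega>. (X \<omega>)\<^sup>2)}"

definition L2_norm :: "'w measure \<Rightarrow> ('w \<Rightarrow> real) \<Rightarrow> real" where
  "L2_norm M X = sqrt (integral\<^sup>L M (\<lambda>\<omega>. (X \<omega>)\<^sup>2))"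

text \<open>The closed linear span of the process, as a set of representatives of its classes
  modulo almost sure equality.\<close>

definition gaussian_space :: "'w measure \<Rightarrow> (real \<Rightarrow> 'w \<Rightarrow> real) \<Rightarrow> ('w \<Rightarrow> real) set" where
  "gaussian_space M B =
     {X \<in> L2 M. \<forall>\<epsilon>>0. \<exists>T c. finite T \<and> T \<subseteq> {0..1} \<and>
        L2_norm M (\<lambda>\<omega>. X \<omega> - (\<Sum>t\<in>T. c t * B t \<omega>)) < \<epsilon>}"

text \<open>\<open>W \<phi>\<close> is an arbitrary representative of the Wiener integral of \<open>\<phi>\<close>; linearity,
  surjectivity and the values on indicators are therefore required almost surely.\<close>

definition is_wiener_integral ::
    "'w measure \<Rightarrow> (real \<Rightarrow> 'w \<Rightarrow> real) \<Rightarrow>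
     ((real \<Rightarrow> real) \<Rightarrow> 'h::{real_inner, complete_space}) \<Rightarrow> ('h \<Rightarrow> 'w \<Rightarrow> real) \<Rightarrow> bool" where
  "is_wiener_integral M B \<iota> W \<longleftrightarrow>
     (\<forall>\<phi>. W \<phi> \<in> gaussian_space M B) \<and>
     (\<forall>X\<in>gaussian_space M B. \<exists>\<phi>. AE \<omega> in M. W \<phi> \<omega> = X \<omega>) \<and>
     (\<forall>\<phi> \<psi> a b. AE \<omega> in M. W (a *\<^sub>R \<phi> + b *\<^sub>R \<psi>) \<omega> = a * W \<phi> \<omega> + b * W \<psi> \<omega>) \<and>
     (\<forall>\<phi>. L2_norm M (W \<phi>) = norm \<phi>) \<and>
     (\<forall>t\<in>{0..1}. AE \<omega> in M. W (\<iota> (indicator {0..t})) \<omega> = B t \<omega>)"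

text \<open>Indices start at \<open>1\<close>; \<open>\<phi> 0\<close> is unconstrained.\<close>

definition is_orthonormal_basis ::
    "(nat \<Rightarrow> 'h::{real_inner, complete_space}) \<Rightarrow> bool" where
  "is_orthonormal_basis \<phi> \<longleftrightarrow>
     (\<forall>m\<ge>1. \<forall>n\<ge>1. inner (\<phi> m) (\<phi> n) = (if m = n then 1 else 0)) \<and>
     closure (span (\<phi> ` {1..})) = UNIV"


section \<open>Hoelder spaces on the unit interval\<close>

definition holder_quotients :: "real \<Rightarrow> (real \<Rightarrow> real) \<Rightarrow> real set" where
  "holder_quotients \<gamma> f =
     {\<bar>f x - f y\<bar> / \<bar>x - y\<bar> powr \<gamma> | x y. x \<in> {0..1} \<and> y \<in> {0..1} \<and> x \<noteq> y}"

definition holder_space :: "real \<Rightarrow> (real \<Rightarrow> real) set" where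
  "holder_space \<gamma> = {f. continuous_on {0..1} f \<and> bdd_above (holder_quotients \<gamma> f)}"

definition holder_norm :: "real \<Rightarrow> (real \<Rightarrow> real) \<Rightarrow> real" where
  "holder_norm \<gamma> f = (SUP x\<in>{0..1}. \<bar>f x\<bar>) + Sup (holder_quotients \<gamma> f)"

text \<open>The real-valued supremum is meaningful only for bounded sets, so membership in the
  space is part of the notion of convergence.\<close>

definition holder_converges ::
    "real \<Rightarrow> (nat \<Rightarrow> real \<Rightarrow> real) \<Rightarrow> (real \<Rightarrow> real) \<Rightarrow> bool" where
  "holder_converges \<gamma> F f \<longleftrightarrow>
     f \<in> holder_space \<gamma> \<and> (\<forall>N. F N \<in> holder_space \<gamma>) \<and>
     (\<lambda>N. holder_norm \<gamma> (\<lambda>t. F N t - f t)) \<longlonglongrightarrow> 0"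

end

(*
  For v in H let Y_N(v) = W(v) - sum_{n<=N} <phi_n, v> W(phi_n), which is almost surely the
  Wiener integral of the Fourier remainder v - sum_{n<=N} <phi_n, v> phi_n.  Gaussian moments
  give E|Y_j(v) - Y_i(v)|^{2m} <= c (F(j) - F(i))^m, where F(N) = sum_{n<=N} <phi_n, v>^2.
  For m >= 2 a bisection argument upgrades this to a bound on the 2m-th moment of
  sup_{k>=N} |Y_k(v)| by K |remainder_N(v)|^{2m}; this replaces the independence of the
  W(phi_n) (Ito-Nisio) or a martingale inequality.  Take v = 1_[0,(k+1)/2^l] - 1_[0,k/2^l], for which
  |v|^2 <= D 2^{-2 l alpha beta}, weight by 2^{2 m gamma l} and sum over all dyadic
  increments.  For m large the sum of the expectations converges and tends to 0 as N grows, by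
  dominated convergence and the completeness of the basis.  Hence the dyadic increments of the
  error, divided by 2^{-gamma l}, tend to 0 uniformly, and dyadic increments control the
  Hoelder norm of a continuous function.
*)
theory Submission
  imports Defs
begin

text \<open>\<open>W\<close> chooses one representative per vector, so each identity about
  \<open>W\<close> holds off a null set depending on the vectors involved. Only countably many such
  identities may be combined: those for dyadic increments and finite partial sums, with rational
  exponents standing in for all exponents. The passage to all pairs of points of the interval is
  then deterministic and rests on the continuity of the paths. An element of the Gaussian space is
  known only as an L^2 limit of Gaussian combinations. Its law is never identified; upper bounds for
  its moments suffice, and these survive the limit by Fatou's lemma. Variances alone (m = 1) would
  not do: each of the two halves in the bisection would carry half of the bound, so nothing would be
  gained. Higher moments of Gaussian variables are powers of the variance, and the power m turns
  additivity of the variance into a strict contraction.\<close>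

section \<open>Dyadic control of the Hoelder norm\<close>

text \<open>Chaining. At a level \<open>l\<close> with |x - y| between 2^-(l+1) and 2^-l the dyadic
  floors of the two points are equal or adjacent, which costs at most one step. Each point is joined
  to its floor by at most one step per finer level, a geometric series of ratio 2^-\<gamma>. This
  gives 1 + 2 / (1 - 2^-\<gamma>); the factor 2^\<gamma> pays for replacing 2^-l by |x - y|.\<close>

lemma holder_bound_from_dyadic:
  fixes f :: "real \<Rightarrow> real"
  assumes cont: "continuous_on {0..1} f"
    and \<gamma>: "0 < \<gamma>" and A: "0 \<le> A"
    and dyadic: "\<And>l k. k < 2 ^ l \<Longrightarrow>
      2 powr (\<gamma> * l) * \<bar>f (real (Suc k) / 2 ^ l) - f (real k / 2 ^ l)\<bar> \<le> A"
    and xy: "x \<in> {0..1}" "y \<in> {0..1}"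
  shows "\<bar>f x - f y\<bar> \<le> 2 powr \<gamma> * (1 + 2 / (1 - 2 powr - \<gamma>)) * A * \<bar>x - y\<bar> powr \<gamma>"
proof -
  define q where "q = (2::real) powr - \<gamma>"
  have q: "0 < q" "q < 1" using \<gamma> by (auto simp: q_def powr_less_one)
  have ql: "2 powr (\<gamma> * real l) * q ^ l = 1" for l
    by (simp add: q_def powr_powr flip: powr_realpow powr_add)
  have step: "\<bar>f (real (Suc k) / 2 ^ l) - f (real k / 2 ^ l)\<bar> \<le> A * q ^ l" if "k < 2 ^ l" for k l
  proof -
    have "\<bar>f (real (Suc k) / 2 ^ l) - f (real k / 2 ^ l)\<bar>
        = (2 powr (\<gamma> * real l) * \<bar>f (real (Suc k) / 2 ^ l) - f (real k / 2 ^ l)\<bar>) * q ^ l"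
      using ql[of l] by (simp add: algebra_simps)
    also have "\<dots> \<le> A * q ^ l"
      using dyadic[OF that] q by (intro mult_right_mono) auto
    finally show ?thesis .
  qed
  define d where "d = (\<lambda>(x::real) l. nat \<lfloor>2 ^ l * x\<rfloor>)"
  have d_real: "real (d x l) = of_int \<lfloor>2 ^ l * x\<rfloor>" if "0 \<le> x" for x l
    using that by (simp add: d_def)
  have d_le: "d x l \<le> 2 ^ l" if "x \<in> {0..1}" for x l
  proof -
    have "real (d x l) \<le> 2 ^ l * x" using that by (simp add: d_real)
    also have "\<dots> \<le> real (2 ^ l)" using that by (simp add: mult_left_le)
    finally show ?thesis by (simp only: of_nat_le_iff)
  qed
  define a where "a = (\<lambda>x l. real (d x l) / 2 ^ l)"
  have a_bounds: "a x l \<le> x" "x - 1 / 2 ^ l \<le> a x l" if "0 \<le> x" for x l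
  proof -
    have "real (d x l) \<le> 2 ^ l * x" "2 ^ l * x - 1 \<le> real (d x l)"
      using floor_correct[of "2 ^ l * x"] by (simp_all add: d_real[OF that])
    then have "real (d x l) / 2 ^ l \<le> 2 ^ l * x / 2 ^ l" "(2 ^ l * x - 1) / 2 ^ l \<le> real (d x l) / 2 ^ l"
      by (intro divide_right_mono; simp)+
    then show "a x l \<le> x" "x - 1 / 2 ^ l \<le> a x l"
      by (simp_all add: a_def diff_divide_distrib)
  qed
  have a_mem: "a x l \<in> {0..1}" if "x \<in> {0..1}" for x l
  proof -
    have "0 \<le> a x l" by (simp add: a_def)
    then show ?thesis using a_bounds(1)[of x l] that by auto
  qed
  have a_lim: "(\<lambda>l. a x l) \<longlonglongrightarrow> x" if "x \<in> {0..1}" for x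
  proof (rule tendsto_sandwich)
    show "(\<lambda>l. x - 1 / 2 ^ l) \<longlonglongrightarrow> x"
      by (rule tendsto_eq_intros LIMSEQ_divide_realpow_zero | simp)+
  qed (use that a_bounds in auto)
  have chain: "\<bar>f (a x (Suc l)) - f (a x l)\<bar> \<le> A * q ^ Suc l" if x: "x \<in> {0..1}" for x l
  proof -
    \<comment> \<open>The next level appends one binary digit: 0 leaves the floor in place, 1 moves
      it by one step of the finer grid.\<close>
    have "d x (Suc l) = 2 * d x l \<or> d x (Suc l) = Suc (2 * d x l)"
    proof -
      have "\<lfloor>2 ^ Suc l * x\<rfloor> = 2 * \<lfloor>2 ^ l * x\<rfloor> \<or> \<lfloor>2 ^ Suc l * x\<rfloor> = 2 * \<lfloor>2 ^ l * x\<rfloor> + 1"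
        using floor_correct[of "2 ^ l * x"] floor_correct[of "2 ^ Suc l * x"]
        by (simp add: algebra_simps) linarith
      moreover have "0 \<le> \<lfloor>2 ^ l * x\<rfloor>" using x by simp
      ultimately show ?thesis unfolding d_def by linarith
    qed
    then show ?thesis
    proof
      assume "d x (Suc l) = 2 * d x l"
      then have "a x (Suc l) = a x l" by (simp add: a_def)
      then show ?thesis using A q by simp
    next
      assume e: "d x (Suc l) = Suc (2 * d x l)"
      have "a x l = real (2 * d x l) / 2 ^ Suc l" by (simp add: a_def)
      moreover have "2 * d x l < 2 ^ Suc l" using d_le[OF x, of "Suc l"] e by linarith
      ultimately show ?thesis using step[of "2 * d x l" "Suc l"] by (simp add: a_def e)
    qed
  qed
  \<comment> \<open>The right-hand side is a partial geometric sum; keeping the factor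
    \<open>1 - q ^ n\<close> lets the induction close.\<close>
  have chain2: "\<bar>f (a x (l + n)) - f (a x l)\<bar> \<le> A * q ^ l / (1 - q) * (1 - q ^ n)" if x: "x \<in> {0..1}" for x l n
  proof (induction n)
    case (Suc n)
    have "\<bar>f (a x (l + Suc n)) - f (a x l)\<bar> \<le> A * q ^ Suc (l + n) + A * q ^ l / (1 - q) * (1 - q ^ n)"
      using chain[OF x, of "l + n"] Suc by simp
    also have "A * q ^ Suc (l + n) \<le> A * q ^ (l + n)"
      using A q by (intro mult_left_mono power_decreasing) auto
    also have "A * q ^ (l + n) + A * q ^ l / (1 - q) * (1 - q ^ n) = A * q ^ l / (1 - q) * (1 - q ^ Suc n)"
      using q by (simp add: field_simps power_add)
    finally show ?case by simp
  qed simp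
  have approx: "\<bar>f x - f (a x l)\<bar> \<le> A * q ^ l / (1 - q)" if x: "x \<in> {0..1}" for x l
  proof -
    have "(\<lambda>n. f (a x n)) \<longlonglongrightarrow> f x"
      by (rule continuous_on_tendsto_compose[OF cont a_lim[OF x] x]) (use a_mem[OF x] in auto)
    then have "(\<lambda>n. f (a x (n + l))) \<longlonglongrightarrow> f x" by (rule LIMSEQ_ignore_initial_segment)
    then have "(\<lambda>n. \<bar>f (a x (n + l)) - f (a x l)\<bar>) \<longlonglongrightarrow> \<bar>f x - f (a x l)\<bar>"
      by (intro tendsto_intros)
    moreover have "\<bar>f (a x (n + l)) - f (a x l)\<bar> \<le> A * q ^ l / (1 - q)" for n
    proof -
      have "\<bar>f (a x (n + l)) - f (a x l)\<bar> \<le> A * q ^ l / (1 - q) * (1 - q ^ n)"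
        using chain2[OF x, of l n] by (simp add: add.commute)
      also have "\<dots> \<le> A * q ^ l / (1 - q)" using A q by (intro mult_left_le) auto
      finally show ?thesis .
    qed
    ultimately show ?thesis by (intro LIMSEQ_le_const2) auto
  qed
  have main: "\<bar>f x - f y\<bar> \<le> 2 powr \<gamma> * (1 + 2 / (1 - q)) * A * \<bar>x - y\<bar> powr \<gamma>"
    if xy: "x \<in> {0..1}" "y \<in> {0..1}" "x < y" for x y
  proof -
    \<comment> \<open>The largest level whose mesh is still at least y - x; since y - x is at most 1
      the logarithm is not positive and \<open>nat\<close> truncates nothing.\<close>
    define l where "l = nat \<lfloor>- log 2 (y - x)\<rfloor>"
    have "log 2 (y - x) \<le> log 2 1" using xy by (subst log_le_cancel_iff) auto
    then have lr: "real l \<le> - log 2 (y - x)" "- log 2 (y - x) < real l + 1"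
      unfolding l_def by (auto simp: of_nat_nat)
    have le: "y - x \<le> 1 / 2 ^ l"
    proof -
      have "y - x = 2 powr (log 2 (y - x))" using xy by simp
      also have "\<dots> \<le> 2 powr (- real l)" using lr by (intro powr_mono) auto
      finally show ?thesis by (simp add: powr_minus powr_realpow divide_inverse)
    qed
    have ge: "q ^ l \<le> 2 powr \<gamma> * \<bar>x - y\<bar> powr \<gamma>"
    proof -
      have "q ^ l = 2 powr (\<gamma> * (- real l))"
        using q by (simp add: q_def powr_powr flip: powr_realpow)
      also have "\<dots> \<le> 2 powr (\<gamma> * (1 + log 2 (y - x)))"
        using lr \<gamma> by (intro powr_mono mult_left_mono) auto
      also have "\<dots> = 2 powr \<gamma> * (2 powr (log 2 (y - x))) powr \<gamma>"
        by (subst powr_powr) (simp add: algebra_simps powr_add)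
      also have "2 powr (log 2 (y - x)) = \<bar>x - y\<bar>" using xy by simp
      finally show ?thesis .
    qed
    have "d y l = d x l \<or> d y l = Suc (d x l)"
    proof -
      have "2 ^ l * (y - x) \<le> 1" using le by (simp add: field_simps)
      moreover have "2 ^ l * x \<le> 2 ^ l * y" using xy by simp
      ultimately have "\<lfloor>2 ^ l * y\<rfloor> = \<lfloor>2 ^ l * x\<rfloor> \<or> \<lfloor>2 ^ l * y\<rfloor> = \<lfloor>2 ^ l * x\<rfloor> + 1"
        using floor_correct[of "2 ^ l * x"] floor_correct[of "2 ^ l * y"]
        by (simp only: right_diff_distrib) linarith
      moreover have "0 \<le> \<lfloor>2 ^ l * x\<rfloor>" using xy by simp
      ultimately show ?thesis unfolding d_def by linarith
    qed
    then have "\<bar>f (a y l) - f (a x l)\<bar> \<le> A * q ^ l"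
    proof
      assume e: "d y l = Suc (d x l)"
      then have "d x l < 2 ^ l" using d_le[OF xy(2), of l] by linarith
      then show ?thesis using step[of "d x l" l] by (simp add: a_def e)
    qed (use A q in \<open>simp add: a_def\<close>)
    then have "\<bar>f x - f y\<bar> \<le> A * q ^ l + 2 * (A * q ^ l / (1 - q))"
      using approx[OF xy(1), of l] approx[OF xy(2), of l] by linarith
    also have "\<dots> = (1 + 2 / (1 - q)) * A * q ^ l" by (simp add: algebra_simps)
    also have "\<dots> \<le> (1 + 2 / (1 - q)) * A * (2 powr \<gamma> * \<bar>x - y\<bar> powr \<gamma>)"
      using ge A q by (intro mult_left_mono mult_nonneg_nonneg) auto
    finally show ?thesis by (simp add: mult_ac)
  qed
  consider "x < y" | "x = y" | "y < x" by linarith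
  then show ?thesis
  proof cases
    case 1
    then show ?thesis using main[of x y] xy by (simp add: q_def)
  next
    case 3
    then show ?thesis using main[of y x] xy by (simp add: q_def abs_minus_commute)
  qed simp
qed

text \<open>Vanishing at 0 makes the supremum of |f| subordinate to the Hoelder quotients, because
  |x|^\<gamma> is at most 1 on the interval. Each of the two parts of the norm costs one
  \<open>C\<close>.\<close>

lemma holder_space_and_norm_bound:
  assumes "continuous_on {0..1} f" and "f 0 = 0" and "0 \<le> C" and \<gamma>: "0 < \<gamma>"
    and bound: "\<And>x y. x \<in> {0..1} \<Longrightarrow> y \<in> {0..1} \<Longrightarrow> \<bar>f x - f y\<bar> \<le> C * \<bar>x - y\<bar> powr \<gamma>"
  shows "f \<in> holder_space \<gamma>" and "\<bar>holder_norm \<gamma> f\<bar> \<le> 2 * C"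
proof -
  have quot: "0 \<le> z \<and> z \<le> C" if "z \<in> holder_quotients \<gamma> f" for z
    using that bound by (auto simp: holder_quotients_def divide_le_eq)
  then have bdd: "bdd_above (holder_quotients \<gamma> f)" by (meson bdd_aboveI)
  then show "f \<in> holder_space \<gamma>" using assms by (simp add: holder_space_def)
  \<comment> \<open>The pair (1, 0) witnesses that the set of quotients is nonempty, without which
    its real supremum would carry no information.\<close>
  have "\<bar>f 1 - f 0\<bar> / \<bar>1 - 0\<bar> powr \<gamma> \<in> holder_quotients \<gamma> f"
    unfolding holder_quotients_def mem_Collect_eq by (intro exI[of _ 1] exI[of _ 0]) simp
  then obtain z where z: "z \<in> holder_quotients \<gamma> f" by blast
  have "Sup (holder_quotients \<gamma> f) \<le> C" using quot z by (intro cSup_least) auto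
  moreover have "0 \<le> Sup (holder_quotients \<gamma> f)" using quot[OF z] cSup_upper[OF z bdd] by linarith
  moreover
  have abs_le: "\<bar>f x\<bar> \<le> C" if "x \<in> {0..1}" for x
  proof -
    have "\<bar>f x\<bar> \<le> C * x powr \<gamma>" using bound[OF that, of 0] that \<open>f 0 = 0\<close> by simp
    also have "\<dots> \<le> C" using that \<open>0 \<le> C\<close> \<gamma> by (intro mult_left_le powr_le1) auto
    finally show ?thesis .
  qed
  then have "(SUP x\<in>{0..1}. \<bar>f x\<bar>) \<le> C" by (intro cSUP_least) auto
  moreover have "0 \<le> (SUP x\<in>{0..1}. \<bar>f x\<bar>)"
    using abs_le \<open>f 0 = 0\<close> by (intro cSUP_upper2[where x = 0]) (auto intro!: bdd_aboveI2[where M = C])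
  ultimately show "\<bar>holder_norm \<gamma> f\<bar> \<le> 2 * C" by (simp add: holder_norm_def)
qed

lemma holder_space_diff:
  assumes "f \<in> holder_space \<gamma>" and "g \<in> holder_space \<gamma>"
  shows "(\<lambda>x. f x - g x) \<in> holder_space \<gamma>"
proof -
  obtain C D where C: "\<And>z. z \<in> holder_quotients \<gamma> f \<Longrightarrow> z \<le> C"
    and D: "\<And>z. z \<in> holder_quotients \<gamma> g \<Longrightarrow> z \<le> D"
    using assms by (auto simp: holder_space_def bdd_above_def)
  have "z \<le> C + D" if z: "z \<in> holder_quotients \<gamma> (\<lambda>x. f x - g x)" for z
  proof -
    obtain x y where xy: "x \<in> {0..1}" "y \<in> {0..1}" "x \<noteq> y"
      and z: "z = \<bar>(f x - g x) - (f y - g y)\<bar> / \<bar>x - y\<bar> powr \<gamma>"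
      using z by (auto simp: holder_quotients_def)
    have "z \<le> (\<bar>f x - f y\<bar> + \<bar>g x - g y\<bar>) / \<bar>x - y\<bar> powr \<gamma>"
      unfolding z by (intro divide_right_mono) auto
    also have "\<dots> \<le> C + D" unfolding add_divide_distrib
      using xy by (intro add_mono C D) (auto simp: holder_quotients_def)
    finally show ?thesis .
  qed
  then show ?thesis using assms
    by (auto simp: holder_space_def intro!: continuous_on_diff bdd_aboveI)
qed

lemma continuous_on_if_holder_bound:
  fixes f :: "real \<Rightarrow> real"
  assumes "0 < \<gamma>" and "0 \<le> C"
    and bound: "\<And>x y. x \<in> S \<Longrightarrow> y \<in> S \<Longrightarrow> \<bar>f x - f y\<bar> \<le> C * \<bar>x - y\<bar> powr \<gamma>"
  shows "continuous_on S f"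
  unfolding continuous_on_def
proof
  fix x assume x: "x \<in> S"
  have "((\<lambda>y. C * \<bar>y - x\<bar> powr \<gamma>) \<longlongrightarrow> C * \<bar>x - x\<bar> powr \<gamma>) (at x within S)"
    using \<open>0 < \<gamma>\<close> by (intro tendsto_intros tendsto_powr') auto
  then have "((\<lambda>y. C * \<bar>y - x\<bar> powr \<gamma>) \<longlongrightarrow> 0) (at x within S)" by simp
  then have "((\<lambda>y. f y - f x) \<longlongrightarrow> 0) (at x within S)"
    by (rule Lim_null_comparison[rotated]) (use bound x in \<open>auto simp: eventually_at_filter\<close>)
  then show "(f \<longlongrightarrow> f x) (at x within S)" by (simp add: LIM_zero_iff)
qed

text \<open>Agreement at 0 fixes the additive constant, so weighted dyadic increments of the error
  control its whole norm. That the limit belongs to the Hoelder space is obtained here and not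
  presupposed.\<close>

lemma holder_converges_if_dyadic:
  fixes F :: "nat \<Rightarrow> real \<Rightarrow> real" and f :: "real \<Rightarrow> real"
  assumes \<gamma>: "0 < \<gamma>" and cont: "continuous_on {0..1} f"
    and F: "\<And>N. F N \<in> holder_space \<gamma>" and zero: "\<And>N. F N 0 = f 0"
    and dyadic: "\<And>\<epsilon>. 0 < \<epsilon> \<Longrightarrow> \<exists>N. \<forall>j\<ge>N. \<forall>l. \<forall>k<2 ^ l.
      2 powr (\<gamma> * l) * \<bar>(F j (real (Suc k) / 2 ^ l) - f (real (Suc k) / 2 ^ l))
        - (F j (real k / 2 ^ l) - f (real k / 2 ^ l))\<bar> \<le> \<epsilon>"
  shows "holder_converges \<gamma> F f"
proof -
  define c where "c = 2 powr \<gamma> * (1 + 2 / (1 - 2 powr - \<gamma>))"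
  have c: "0 < c" using \<gamma> by (auto simp: c_def powr_less_one intro!: mult_pos_pos add_pos_pos)
  define g where "g = (\<lambda>N t. F N t - f t)"
  have g: "\<exists>N. \<forall>j\<ge>N. g j \<in> holder_space \<gamma> \<and> \<bar>holder_norm \<gamma> (g j)\<bar> \<le> 2 * (c * \<epsilon>)"
    if \<epsilon>: "0 < \<epsilon>" for \<epsilon>
  proof -
    obtain N where N: "\<And>j l k. N \<le> j \<Longrightarrow> k < 2 ^ l \<Longrightarrow>
        2 powr (\<gamma> * real l) * \<bar>g j (real (Suc k) / 2 ^ l) - g j (real k / 2 ^ l)\<bar> \<le> \<epsilon>"
      using dyadic[OF \<epsilon>] unfolding g_def by blast
    have "g j \<in> holder_space \<gamma> \<and> \<bar>holder_norm \<gamma> (g j)\<bar> \<le> 2 * (c * \<epsilon>)" if j: "N \<le> j" for j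
    proof -
      have cont_g: "continuous_on {0..1} (g j)"
        using F[of j] cont unfolding g_def holder_space_def by (auto intro!: continuous_on_diff)
      have bound: "\<bar>g j x - g j y\<bar> \<le> c * \<epsilon> * \<bar>x - y\<bar> powr \<gamma>" if "x \<in> {0..1}" "y \<in> {0..1}" for x y
        unfolding c_def
        by (rule holder_bound_from_dyadic[OF cont_g \<gamma> less_imp_le[OF \<epsilon>] N[OF j] that])
      have "g j 0 = 0" by (simp add: g_def zero)
      note holder_space_and_norm_bound[OF cont_g this _ \<gamma> bound]
      then show ?thesis using c \<epsilon> by simp
    qed
    then show ?thesis by blast
  qed
  \<comment> \<open>One error that is Hoelder is enough: the limit is a partial sum minus its
    error.\<close>
  from g[of 1] obtain N where "g N \<in> holder_space \<gamma>" by auto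
  then have "(\<lambda>t. F N t - g N t) \<in> holder_space \<gamma>" by (rule holder_space_diff[OF F])
  then have "f \<in> holder_space \<gamma>" by (simp add: g_def)
  moreover have "(\<lambda>N. holder_norm \<gamma> (g N)) \<longlonglongrightarrow> 0"
  proof (rule LIMSEQ_I)
    fix r :: real assume r: "0 < r"
    then have "0 < r / (4 * c)" using c by simp
    from g[OF this] obtain N where "\<And>j. N \<le> j \<Longrightarrow> \<bar>holder_norm \<gamma> (g j)\<bar> \<le> 2 * (c * (r / (4 * c)))"
      by blast
    moreover have "2 * (c * (r / (4 * c))) < r" using c r by (simp add: field_simps)
    ultimately have "\<And>j. N \<le> j \<Longrightarrow> \<bar>holder_norm \<gamma> (g j)\<bar> < r" by (meson le_less_trans)
    then show "\<exists>N. \<forall>j\<ge>N. norm (holder_norm \<gamma> (g j) - 0) < r" by auto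
  qed
  ultimately show ?thesis using F by (simp add: holder_converges_def g_def)
qed

section \<open>Increments of the covariance\<close>

text \<open>The power mean inequality: midpoint convexity of x^(1/\<beta>) at the points a^\<beta>
  and b^\<beta>, raised back to the power \<beta>. Equality holds at a = b.\<close>

lemma powr_sum_le:
  fixes a b :: real
  assumes "0 \<le> a" "0 \<le> b" "0 < \<beta>" "\<beta> \<le> 1"
  shows "a powr \<beta> + b powr \<beta> \<le> 2 powr (1 - \<beta>) * (a + b) powr \<beta>"
proof (cases "a = 0 \<or> b = 0")
  case True
  have "1 \<le> (2::real) powr (1 - \<beta>)" using assms by (intro ge_one_powr_ge_zero) auto
  then show ?thesis using True assms by (auto simp: mult_le_cancel_right1)
next
  case False
  then have ab: "0 < a" "0 < b" using assms by auto
  have "convex_on {0<..} (\<lambda>x::real. x powr (1 / \<beta>))" using assms by (intro powr_convex) auto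
  from convex_onD[OF this, of "1/2" "a powr \<beta>" "b powr \<beta>"] ab
  have "((a powr \<beta> + b powr \<beta>) / 2) powr (1 / \<beta>) \<le> (a + b) / 2"
    using assms by (simp add: powr_powr add_divide_distrib)
  then have "(((a powr \<beta> + b powr \<beta>) / 2) powr (1 / \<beta>)) powr \<beta> \<le> ((a + b) / 2) powr \<beta>"
    using assms by (intro powr_mono2) auto
  then have "(a powr \<beta> + b powr \<beta>) / 2 \<le> (a + b) powr \<beta> / 2 powr \<beta>"
    using assms ab by (simp add: powr_powr powr_divide)
  then show ?thesis by (simp add: powr_diff field_simps)
qed

text \<open>With a = t^(2\<alpha>) and b = s^(2\<alpha>) the left side is a^\<beta> + b^\<beta> -
  2^(1-\<beta>) (a + b)^\<beta> plus the right side, and the power mean inequality makes the first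
  part nonpositive.\<close>

lemma bifractional_cov_increment:
  assumes "0 < \<alpha>" "0 < \<beta>" "\<beta> \<le> 1" "0 \<le> s" "0 \<le> t"
  shows "bifractional_cov \<alpha> \<beta> t t - 2 * bifractional_cov \<alpha> \<beta> s t + bifractional_cov \<alpha> \<beta> s s
    \<le> 2 powr (1 - \<beta>) * \<bar>t - s\<bar> powr (2 * \<alpha> * \<beta>)"
proof -
  have diag: "bifractional_cov \<alpha> \<beta> u u = (u powr (2 * \<alpha>)) powr \<beta>" if "0 \<le> u" for u
    using that by (simp add: bifractional_cov_def powr_mult flip: mult_2)
  show ?thesis
    using powr_sum_le[of "t powr (2 * \<alpha>)" "s powr (2 * \<alpha>)" \<beta>] assms
    by (simp add: diag) (simp add: bifractional_cov_def powr_diff right_diff_distrib)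
qed

lemma completion_inner:
  assumes "is_completion \<alpha> \<beta> \<iota>" "s \<in> {0..1}" "t \<in> {0..1}"
  shows "inner (\<iota> (indicator {0..t})) (\<iota> (indicator {0..s})) = bifractional_cov \<alpha> \<beta> s t"
  using assms(1)[unfolded is_completion_def, THEN conjunct2, THEN conjunct1] assms(2,3) by blast

text \<open>The rest of the proof sees the covariance only through this estimate and through R(0,0)
  = 0.\<close>

lemma norm_indicator_increment:
  fixes \<iota> :: "(real \<Rightarrow> real) \<Rightarrow> 'h::{real_inner, complete_space}"
  assumes "is_completion \<alpha> \<beta> \<iota>" "0 < \<alpha>" "0 < \<beta>" "\<beta> \<le> 1" "s \<in> {0..1}" "t \<in> {0..1}"
  shows "(norm (\<iota> (indicator {0..t}) - \<iota> (indicator {0..s})))\<^sup>2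
    \<le> 2 powr (1 - \<beta>) * \<bar>t - s\<bar> powr (2 * \<alpha> * \<beta>)"
proof -
  note ip = completion_inner[OF assms(1)]
  show ?thesis
    using bifractional_cov_increment[of \<alpha> \<beta> s t] assms(2-)
    unfolding power2_norm_eq_inner
    by (simp add: inner_diff_left inner_diff_right ip inner_commute[of "\<iota> (indicator {0..s})" "\<iota> (indicator {0..t})"])
qed

section \<open>A maximal inequality without independence\<close>

lemma ennreal_linear_combination:
  assumes "0 \<le> a" "0 \<le> b" "0 \<le> x" "0 \<le> y"
  shows "ennreal (a * x + b * y) = ennreal a * ennreal x + ennreal b * ennreal y"
  using assms by (simp only: ennreal_plus ennreal_mult mult_nonneg_nonneg)

text \<open>If b is at most d a, the sum is at most (1 + d) a; otherwise it is at most (1 + 1/d) b.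
  Choosing d small brings the first coefficient below \<theta>. A coefficient close to 1 is
  essential: the convexity bound with factor 2^(p-1) would destroy the gain of the
  bisection.\<close>

lemma add_power_le:
  fixes \<theta> :: real
  assumes "1 < \<theta>"
  obtains C where "0 \<le> C"
    and "\<And>a b::real. 0 \<le> a \<Longrightarrow> 0 \<le> b \<Longrightarrow> (a + b) ^ p \<le> \<theta> * a ^ p + C * b ^ p"
proof -
  have "isCont (\<lambda>d::real. (1 + d) ^ p) 0" by (intro continuous_intros)
  then have "((\<lambda>d::real. (1 + d) ^ p) \<longlongrightarrow> 1) (at_right 0)"
    by (simp add: isCont_def filterlim_at_split)
  then have "eventually (\<lambda>d. (1 + d) ^ p < \<theta>) (at_right 0)"
    using assms by (intro order_tendstoD(2)) auto
  moreover have "eventually (\<lambda>d::real. 0 < d) (at_right 0)"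
    by (simp add: eventually_at_right_less)
  ultimately have "eventually (\<lambda>d. 0 < d \<and> (1 + d) ^ p < \<theta>) (at_right 0)"
    by eventually_elim simp
  then obtain d where d: "0 < d" "(1 + d) ^ p < \<theta>"
    by (metis (mono_tags, lifting) eventually_happens trivial_limit_at_right_real)
  show thesis
  proof (rule that)
    show "0 \<le> (1 + 1 / d) ^ p" using d by simp
    fix a b :: real
    assume ab: "0 \<le> a" "0 \<le> b"
    show "(a + b) ^ p \<le> \<theta> * a ^ p + (1 + 1 / d) ^ p * b ^ p"
    proof (cases "b \<le> d * a")
      case True
      have "(a + b) ^ p \<le> ((1 + d) * a) ^ p"
        using True ab by (intro power_mono) (auto simp: algebra_simps)
      also have "\<dots> = (1 + d) ^ p * a ^ p" by (rule power_mult_distrib)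
      also have "\<dots> \<le> \<theta> * a ^ p" using d ab by (intro mult_right_mono) auto
      finally show ?thesis using d ab by (simp add: add_increasing2)
    next
      case False
      have "a \<le> b / d" using False d by (simp add: field_simps)
      then have "(a + b) ^ p \<le> ((1 + 1 / d) * b) ^ p"
        using ab by (intro power_mono) (auto simp: algebra_simps)
      also have "\<dots> = (1 + 1 / d) ^ p * b ^ p" by (rule power_mult_distrib)
      finally show ?thesis using assms ab by (simp add: add_increasing)
    qed
  qed
qed

text \<open>
  Moricz--Billingsley bisection: cutting the index range where \<open>F\<close> has made half of its
  increase, each half contributes \<open>2 powr - m\<close> of the bound, and the total factor
  \<open>3/2 * 2 * 2 powr - m\<close> is at most \<open>3/4\<close> once \<open>m \<ge> 2\<close>. The increments need not be
  independent.
\<close>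

lemma maximal_moment_inequality:
  fixes S :: "nat \<Rightarrow> 'w \<Rightarrow> real" and F :: "nat \<Rightarrow> real"
  assumes m: "2 \<le> m" and "0 \<le> c" and "0 \<le> C" and F: "mono F"
    and [measurable]: "\<And>n. S n \<in> borel_measurable M"
    and C: "\<And>a b::real. 0 \<le> a \<Longrightarrow> 0 \<le> b \<Longrightarrow> (a + b) ^ p \<le> 3 / 2 * a ^ p + C * b ^ p"
    and moment: "\<And>i j. i \<le> j \<Longrightarrow>
      (\<integral>\<^sup>+\<omega>. ennreal (\<bar>S j \<omega> - S i \<omega>\<bar> ^ p) \<partial>M) \<le> ennreal (c * (F j - F i) ^ m)"
    and "i \<le> j" and p: "0 < p"
  shows "(\<integral>\<^sup>+\<omega>. (SUP k\<in>{i..j}. ennreal (\<bar>S k \<omega> - S i \<omega>\<bar> ^ p)) \<partial>M)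
    \<le> ennreal (4 * C * c * (F j - F i) ^ m)"
  using \<open>i \<le> j\<close>
proof (induction "j - i" arbitrary: i j rule: less_induct)
  case less
  define Z where "Z = (\<lambda>i j \<omega>. SUP k\<in>{i..j}. ennreal (\<bar>S k \<omega> - S i \<omega>\<bar> ^ p))"
  have [measurable]: "Z i j \<in> borel_measurable M" for i j unfolding Z_def by measurable
  show ?case
  proof (cases "i = j")
    case True
    then show ?thesis using p by (simp add: zero_power)
  next
    case False
    with less have ij: "i < j" by simp
    define T where "T = F j - F i"
    have T: "0 \<le> T" using ij F by (simp add: T_def monoD)
    \<comment> \<open>The first index after \<open>i\<close> at which half of the increase is
      reached. The ranges from \<open>i\<close> to \<open>h - 1\<close> and from \<open>h\<close> to
      \<open>j\<close> each carry at most \<open>T / 2\<close>; the jump from \<open>h - 1\<close>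
      to \<open>h\<close> may be large and is absorbed by the single increment
      \<open>S h - S i\<close>. Requiring \<open>i < h\<close> keeps both ranges strictly shorter,
      even when \<open>T = 0\<close>.\<close>
    define h where "h = (LEAST h. i < h \<and> F i + T / 2 \<le> F h)"
    have "i < j \<and> F i + T / 2 \<le> F j" using ij T by (simp add: T_def field_simps)
    then have h: "i < h" "F i + T / 2 \<le> F h" "h \<le> j"
      unfolding h_def by (metis (mono_tags, lifting) LeastI Least_le)+
    have h1: "F (h - 1) - F i \<le> T / 2"
    proof (cases "h - 1 = i")
      case False
      then have "i < h - 1" "h - 1 < h" using h by auto
      then have "\<not> F i + T / 2 \<le> F (h - 1)" unfolding h_def using not_less_Least by blast
      then show ?thesis by simp
    qed (use T in simp)
    have h2: "F j - F h \<le> T / 2" using h(2) T_def by linarith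
    have half: "c' * x ^ m \<le> c' * (T / 2) ^ m" if "0 \<le> x" "x \<le> T / 2" "0 \<le> c'" for c' x
      using that by (intro mult_left_mono power_mono) auto
    have "(\<integral>\<^sup>+\<omega>. Z i (h - 1) \<omega> \<partial>M) \<le> ennreal (4 * C * c * (F (h - 1) - F i) ^ m)"
      unfolding Z_def using h by (intro less) auto
    also have "\<dots> \<le> ennreal (4 * C * c * (T / 2) ^ m)"
      using h1 h F \<open>0 \<le> c\<close> \<open>0 \<le> C\<close> by (intro ennreal_leI half) (auto simp: monoD)
    finally have left: "(\<integral>\<^sup>+\<omega>. Z i (h - 1) \<omega> \<partial>M) \<le> ennreal (4 * C * c * (T / 2) ^ m)" .
    have "(\<integral>\<^sup>+\<omega>. Z h j \<omega> \<partial>M) \<le> ennreal (4 * C * c * (F j - F h) ^ m)"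
      unfolding Z_def using h by (intro less) auto
    also have "\<dots> \<le> ennreal (4 * C * c * (T / 2) ^ m)"
      using h2 h F \<open>0 \<le> c\<close> \<open>0 \<le> C\<close> by (intro ennreal_leI half) (auto simp: monoD)
    finally have right: "(\<integral>\<^sup>+\<omega>. Z h j \<omega> \<partial>M) \<le> ennreal (4 * C * c * (T / 2) ^ m)" .
    have mid: "(\<integral>\<^sup>+\<omega>. ennreal (\<bar>S h \<omega> - S i \<omega>\<bar> ^ p) \<partial>M) \<le> ennreal (c * T ^ m)"
    proof -
      have "c * (F h - F i) ^ m \<le> c * T ^ m"
        using h F \<open>0 \<le> c\<close> by (intro mult_left_mono power_mono) (auto simp: T_def monoD)
      then show ?thesis using moment[of i h] h by (meson ennreal_leI less_imp_le order_trans)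
    qed
    \<comment> \<open>Indices before \<open>h\<close> belong to the left range. Later ones are
      reached through \<open>h\<close>, where the coefficient 3/2 falls on the right range. Bounding
      the larger of the two ranges by their sum costs the factor 2.\<close>
    have split: "Z i j \<omega> \<le> ennreal (3 / 2) * (Z i (h - 1) \<omega> + Z h j \<omega>) + ennreal C * ennreal (\<bar>S h \<omega> - S i \<omega>\<bar> ^ p)" for \<omega>
    proof (subst (1) Z_def, rule SUP_least)
      fix k assume k: "k \<in> {i..j}"
      show "ennreal (\<bar>S k \<omega> - S i \<omega>\<bar> ^ p)
        \<le> ennreal (3 / 2) * (Z i (h - 1) \<omega> + Z h j \<omega>) + ennreal C * ennreal (\<bar>S h \<omega> - S i \<omega>\<bar> ^ p)"
      proof (cases "k < h")
        case True
        have "ennreal (\<bar>S k \<omega> - S i \<omega>\<bar> ^ p) \<le> Z i (h - 1) \<omega>"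
          unfolding Z_def using True k by (intro SUP_upper) auto
        also have "\<dots> \<le> ennreal (3 / 2) * Z i (h - 1) \<omega>"
        proof -
          have "ennreal 1 \<le> ennreal (3 / 2)" by (intro ennreal_leI) simp
          then show ?thesis using mult_right_mono[of 1 "ennreal (3 / 2)" "Z i (h - 1) \<omega>"] by simp
        qed
        finally show ?thesis
          by (simp add: distrib_left add_increasing2 add.assoc)
      next
        case False
        have "\<bar>S k \<omega> - S i \<omega>\<bar> ^ p \<le> (\<bar>S k \<omega> - S h \<omega>\<bar> + \<bar>S h \<omega> - S i \<omega>\<bar>) ^ p"
          by (intro power_mono) auto
        also have "\<dots> \<le> 3 / 2 * \<bar>S k \<omega> - S h \<omega>\<bar> ^ p + C * \<bar>S h \<omega> - S i \<omega>\<bar> ^ p"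
          by (intro C) auto
        finally have "ennreal (\<bar>S k \<omega> - S i \<omega>\<bar> ^ p)
            \<le> ennreal (3 / 2 * \<bar>S k \<omega> - S h \<omega>\<bar> ^ p + C * \<bar>S h \<omega> - S i \<omega>\<bar> ^ p)"
          by (rule ennreal_leI)
        also have "\<dots> = ennreal (3 / 2) * ennreal (\<bar>S k \<omega> - S h \<omega>\<bar> ^ p) + ennreal C * ennreal (\<bar>S h \<omega> - S i \<omega>\<bar> ^ p)"
          using \<open>0 \<le> C\<close> by (intro ennreal_linear_combination) auto
        also have "\<dots> \<le> ennreal (3 / 2) * Z h j \<omega> + ennreal C * ennreal (\<bar>S h \<omega> - S i \<omega>\<bar> ^ p)"
          unfolding Z_def using False k by (intro add_right_mono mult_left_mono SUP_upper) auto
        finally show ?thesis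
          by (simp add: distrib_left add_increasing add.assoc)
      qed
    qed
    have "(\<integral>\<^sup>+\<omega>. Z i j \<omega> \<partial>M)
        \<le> (\<integral>\<^sup>+\<omega>. ennreal (3 / 2) * (Z i (h - 1) \<omega> + Z h j \<omega>) + ennreal C * ennreal (\<bar>S h \<omega> - S i \<omega>\<bar> ^ p) \<partial>M)"
      by (intro nn_integral_mono split)
    also have "\<dots> = ennreal (3 / 2) * ((\<integral>\<^sup>+\<omega>. Z i (h - 1) \<omega> \<partial>M) + (\<integral>\<^sup>+\<omega>. Z h j \<omega> \<partial>M))
        + ennreal C * (\<integral>\<^sup>+\<omega>. ennreal (\<bar>S h \<omega> - S i \<omega>\<bar> ^ p) \<partial>M)"
      by (simp add: nn_integral_add nn_integral_cmult)
    also have "\<dots> \<le> ennreal (3 / 2) * (ennreal (4 * C * c * (T / 2) ^ m) + ennreal (4 * C * c * (T / 2) ^ m))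
        + ennreal C * ennreal (c * T ^ m)"
      using left right mid by (intro add_mono mult_mono) auto
    also have "\<dots> = ennreal (3 / 2 * (4 * C * c * (T / 2) ^ m + 4 * C * c * (T / 2) ^ m) + C * (c * T ^ m))"
    proof -
      have nonneg: "0 \<le> 4 * C * c * (T / 2) ^ m" "0 \<le> c * T ^ m"
        using T \<open>0 \<le> c\<close> \<open>0 \<le> C\<close> by simp_all
      show ?thesis
        by (simp only: ennreal_plus[OF nonneg(1) nonneg(1), symmetric])
          (rule ennreal_linear_combination[symmetric]; use nonneg \<open>0 \<le> C\<close> in simp)
    qed
    \<comment> \<open>This explains the constant 4: the halves contribute at most 3/4 of 4 and the
      middle increment contributes 1, so the bound reproduces itself.\<close>
    also have "\<dots> \<le> ennreal (4 * C * c * T ^ m)"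
    proof (rule ennreal_leI)
      have "(1 / 2 :: real) ^ m \<le> (1 / 2) ^ 2" using m by (intro power_decreasing) auto
      then have "12 * (C * c * T ^ m) * (1 / 2) ^ m \<le> 12 * (C * c * T ^ m) * (1 / 4)"
        using T \<open>0 \<le> c\<close> \<open>0 \<le> C\<close> by (intro mult_left_mono) (auto simp: power2_eq_square)
      then show "3 / 2 * (4 * C * c * (T / 2) ^ m + 4 * C * c * (T / 2) ^ m) + C * (c * T ^ m) \<le> 4 * C * c * T ^ m"
        by (simp add: power_divide mult_ac)
    qed
    finally show ?thesis by (simp add: Z_def T_def)
  qed
qed

section \<open>Fourier remainders\<close>

definition fourier_rem :: "(nat \<Rightarrow> 'h::real_inner) \<Rightarrow> nat \<Rightarrow> 'h \<Rightarrow> 'h" where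
  "fourier_rem \<phi> N v = v - (\<Sum>n = 1..N. inner (\<phi> n) v *\<^sub>R \<phi> n)"

text \<open>The control function of the bisection: its increments are the squared norms of the
  increments of the remainder, by orthonormality.\<close>

definition fourier_mass :: "(nat \<Rightarrow> 'h::real_inner) \<Rightarrow> 'h \<Rightarrow> nat \<Rightarrow> real" where
  "fourier_mass \<phi> v N = (\<Sum>n = 1..N. (inner (\<phi> n) v)\<^sup>2)"

lemma mono_fourier_mass: "mono (fourier_mass \<phi> v)"
  unfolding fourier_mass_def by (intro monoI sum_mono2) auto

context
  fixes \<phi> :: "nat \<Rightarrow> 'h::{real_inner, complete_space}"
  assumes basis: "is_orthonormal_basis \<phi>"
begin

lemma inner_basis: "1 \<le> m \<Longrightarrow> 1 \<le> n \<Longrightarrow> inner (\<phi> m) (\<phi> n) = (if m = n then 1 else 0)"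
  using basis by (simp add: is_orthonormal_basis_def)

lemma norm_basis_sum:
  assumes "finite I" and "I \<subseteq> {1..}"
  shows "(norm (\<Sum>n\<in>I. a n *\<^sub>R \<phi> n))\<^sup>2 = (\<Sum>n\<in>I. (a n)\<^sup>2)"
proof -
  have "inner (\<Sum>n\<in>I. a n *\<^sub>R \<phi> n) (\<phi> k) = a k" if "k \<in> I" for k
  proof -
    have "inner (\<Sum>n\<in>I. a n *\<^sub>R \<phi> n) (\<phi> k) = (\<Sum>n\<in>I. if n = k then a n else 0)"
      unfolding inner_sum_left inner_scaleR_left
      using assms that by (intro sum.cong) (auto simp: inner_basis subset_eq)
    then show ?thesis using assms that by simp
  qed
  then have "(\<Sum>k\<in>I. inner (\<Sum>n\<in>I. a n *\<^sub>R \<phi> n) (a k *\<^sub>R \<phi> k)) = (\<Sum>k\<in>I. (a k)\<^sup>2)"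
    by (intro sum.cong refl) (simp add: power2_eq_square)
  then show ?thesis by (simp only: power2_norm_eq_inner inner_sum_right)
qed

lemma norm_fourier_rem: "(norm (fourier_rem \<phi> N v))\<^sup>2 = (norm v)\<^sup>2 - fourier_mass \<phi> v N"
proof -
  let ?p = "\<Sum>n = 1..N. inner (\<phi> n) v *\<^sub>R \<phi> n"
  have "inner ?p v = fourier_mass \<phi> v N"
    by (simp add: inner_sum_left fourier_mass_def power2_eq_square)
  moreover from this have "inner v ?p = fourier_mass \<phi> v N" by (subst inner_commute)
  moreover have "inner ?p ?p = fourier_mass \<phi> v N"
    using norm_basis_sum[of "{1..N}" "\<lambda>n. inner (\<phi> n) v"]
    by (simp add: fourier_mass_def power2_norm_eq_inner)
  ultimately show ?thesis
    unfolding fourier_rem_def power2_norm_eq_inner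
    by (simp add: inner_diff_left inner_diff_right)
qed

lemma norm_fourier_rem_le: "norm (fourier_rem \<phi> N v) \<le> norm v"
proof (rule power2_le_imp_le)
  show "(norm (fourier_rem \<phi> N v))\<^sup>2 \<le> (norm v)\<^sup>2"
    unfolding norm_fourier_rem by (simp add: fourier_mass_def sum_nonneg)
qed simp

lemma norm_fourier_rem_diff:
  assumes "i \<le> j"
  shows "(norm (fourier_rem \<phi> j v - fourier_rem \<phi> i v))\<^sup>2 = fourier_mass \<phi> v j - fourier_mass \<phi> v i"
proof -
  have "{1..j} = {1..i} \<union> {Suc i..j}" using assms by auto
  moreover have "{1..i} \<inter> {Suc i..j} = {}" by auto
  ultimately have "fourier_rem \<phi> i v - fourier_rem \<phi> j v = (\<Sum>n = Suc i..j. inner (\<phi> n) v *\<^sub>R \<phi> n)"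
    and "fourier_mass \<phi> v j - fourier_mass \<phi> v i = (\<Sum>n = Suc i..j. (inner (\<phi> n) v)\<^sup>2)"
    unfolding fourier_rem_def fourier_mass_def by (simp_all add: sum.union_disjoint)
  then show ?thesis
    using norm_basis_sum[of "{Suc i..j}" "\<lambda>n. inner (\<phi> n) v"] by (simp add: norm_minus_commute)
qed

lemma fourier_rem_linear:
  "fourier_rem \<phi> N (x + y) = fourier_rem \<phi> N x + fourier_rem \<phi> N y"
  "fourier_rem \<phi> N (x - y) = fourier_rem \<phi> N x - fourier_rem \<phi> N y"
  "fourier_rem \<phi> N (c *\<^sub>R x) = c *\<^sub>R fourier_rem \<phi> N x"
  by (simp_all add: fourier_rem_def inner_add_right inner_diff_right scaleR_add_left
      scaleR_left_diff_distrib sum.distrib sum_subtractf scaleR_right_diff_distrib scaleR_sum_right)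

text \<open>A basis vector is reproduced exactly once its index has been passed, and a vector of the
  span involves finitely many of them.\<close>

lemma fourier_rem_span:
  assumes "w \<in> span (\<phi> ` {1..})"
  shows "\<forall>\<^sub>F N in sequentially. fourier_rem \<phi> N w = 0"
  using assms
proof (induction rule: span_induct_alt)
  case base
  then show ?case by (simp add: fourier_rem_def)
next
  case (step c x y)
  then obtain k where k: "1 \<le> k" "x = \<phi> k" by auto
  have "\<forall>\<^sub>F N in sequentially. fourier_rem \<phi> N x = 0"
    using eventually_ge_at_top[of k]
  proof eventually_elim
    case (elim N)
    have "(\<Sum>n = 1..N. inner (\<phi> n) (\<phi> k) *\<^sub>R \<phi> n) = (\<Sum>n = 1..N. if n = k then \<phi> k else 0)"
      using k by (intro sum.cong) (auto simp: inner_basis)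
    then show ?case using elim k by (simp add: fourier_rem_def)
  qed
  then show ?case using step.IH by eventually_elim (simp add: fourier_rem_linear)
qed

text \<open>Completeness of the basis enters here: the remainder maps are linear contractions, and
  on a dense subspace they eventually vanish.\<close>

lemma fourier_rem_tendsto_0: "(\<lambda>N. norm (fourier_rem \<phi> N v)) \<longlonglongrightarrow> 0"
proof (rule LIMSEQ_I)
  fix r :: real
  assume "0 < r"
  have "v \<in> closure (span (\<phi> ` {1..}))" using basis by (simp add: is_orthonormal_basis_def)
  then obtain w where w: "w \<in> span (\<phi> ` {1..})" "dist w v < r"
    using \<open>0 < r\<close> by (meson closure_approachable)
  obtain N0 where N0: "\<And>N. N0 \<le> N \<Longrightarrow> fourier_rem \<phi> N w = 0"
    using fourier_rem_span[OF w(1)] by (auto simp: eventually_sequentially)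
  have "norm (norm (fourier_rem \<phi> N v) - 0) < r" if "N0 \<le> N" for N
    using norm_fourier_rem_le[of N "v - w"] w(2) N0[OF that]
    by (simp add: fourier_rem_linear dist_norm norm_minus_commute)
  then show "\<exists>no. \<forall>N\<ge>no. norm (norm (fourier_rem \<phi> N v) - 0) < r" by blast
qed

end

section \<open>Moments on the Gaussian space\<close>

lemma gaussian_rv_measurable: "gaussian_rv M X \<Longrightarrow> X \<in> borel_measurable M"
  by (simp add: gaussian_rv_def)

lemma gaussian_rv_integrable:
  assumes "prob_space M" and "gaussian_rv M X"
  shows "integrable M X"
proof -
  interpret prob_space M by fact
  have [measurable]: "X \<in> borel_measurable M" using assms(2) by (rule gaussian_rv_measurable)
  from assms(2) obtain \<mu> where "(AE \<omega> in M. X \<omega> = \<mu>) \<or>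
      (\<exists>\<sigma>>0. distributed M lborel X (normal_density \<mu> \<sigma>))"
    unfolding gaussian_rv_def by (elim conjE exE)
  then show ?thesis
  proof (elim disjE exE conjE)
    assume "AE \<omega> in M. X \<omega> = \<mu>"
    then have "integrable M X \<longleftrightarrow> integrable M (\<lambda>_. \<mu>)" by (intro integrable_cong_AE) auto
    then show ?thesis by simp
  next
    fix \<sigma> :: real
    assume \<sigma>: "0 < \<sigma>" and D: "distributed M lborel X (normal_density \<mu> \<sigma>)"
    have "integrable lborel (\<lambda>x. normal_density \<mu> \<sigma> x * x)"
      using \<sigma> by (rule integrable_normal_moment_nz_1)
    then show ?thesis using distributed_integrable[OF D, of "\<lambda>x. x"] \<sigma> by simp
  qed
qed

text \<open>The coefficient is the double factorial (2k-1)!!. Degenerate variables have to be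
  included, since combinations of the process may be almost surely constant.\<close>

lemma centred_gaussian_even_moment:
  assumes "prob_space M" and "gaussian_rv M X" and mean: "integral\<^sup>L M X = 0" and k: "0 < k"
  shows "has_bochner_integral M (\<lambda>\<omega>. X \<omega> ^ (2 * k))
    (fact (2 * k) / (2 ^ k * fact k) * (integral\<^sup>L M (\<lambda>\<omega>. (X \<omega>)\<^sup>2)) ^ k)"
proof -
  interpret prob_space M by fact
  have [measurable]: "X \<in> borel_measurable M" using assms(2) by (rule gaussian_rv_measurable)
  from assms(2) obtain \<mu> where "(AE \<omega> in M. X \<omega> = \<mu>) \<or>
      (\<exists>\<sigma>>0. distributed M lborel X (normal_density \<mu> \<sigma>))"
    unfolding gaussian_rv_def by (elim conjE exE)
  then show ?thesis
  proof (elim disjE exE conjE)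
    assume ae: "AE \<omega> in M. X \<omega> = \<mu>"
    then have "integral\<^sup>L M X = integral\<^sup>L M (\<lambda>_. \<mu>)" by (intro integral_cong_AE) auto
    then have "\<mu> = 0" using mean by (simp add: prob_space)
    with ae have zero: "AE \<omega> in M. X \<omega> = 0" by simp
    then have "integral\<^sup>L M (\<lambda>\<omega>. (X \<omega>)\<^sup>2) = integral\<^sup>L M (\<lambda>_. 0)"
      by (intro integral_cong_AE) auto
    moreover have "has_bochner_integral M (\<lambda>\<omega>. X \<omega> ^ (2 * k)) 0"
    proof (subst has_bochner_integral_cong_AE)
      show "AE \<omega> in M. X \<omega> ^ (2 * k) = 0" using zero by eventually_elim (use k in simp)
    qed (simp_all add: has_bochner_integral_zero)
    ultimately show ?thesis using k by (simp add: has_bochner_integral_zero zero_power)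
  next
    fix \<sigma> :: real
    assume \<sigma>: "0 < \<sigma>" and D: "distributed M lborel X (normal_density \<mu> \<sigma>)"
    have "\<mu> = integral\<^sup>L lborel (\<lambda>x. normal_density \<mu> \<sigma> x * x)"
      using \<sigma> by (simp add: integral_normal_moment_nz_1)
    also have "\<dots> = 0" using distributed_integral[OF D, of "\<lambda>x. x"] mean by simp
    finally have \<mu>: "\<mu> = 0" .
    \<comment> \<open>Stated for every \<open>j\<close> because the case \<open>j = 1\<close>
      identifies \<sigma>^2 with the second moment.\<close>
    have int: "integrable M (\<lambda>\<omega>. X \<omega> ^ (2 * j))"
      and val: "integral\<^sup>L M (\<lambda>\<omega>. X \<omega> ^ (2 * j)) = fact (2 * j) / ((2 / \<sigma>\<^sup>2) ^ j * fact j)" for j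
      using normal_moment_even[OF \<sigma>, of 0 j] distributed_integrable[OF D, of "\<lambda>x. x ^ (2 * j)"]
        distributed_integral[OF D, of "\<lambda>x. x ^ (2 * j)"]
      by (auto simp: \<mu> has_bochner_integral_iff)
    have "integral\<^sup>L M (\<lambda>\<omega>. (X \<omega>)\<^sup>2) = \<sigma>\<^sup>2"
      using val[of 1] \<sigma> by (simp add: fact_numeral)
    then show ?thesis using int[of k] val[of k]
      by (simp add: has_bochner_integral_iff power_divide mult.commute)
  qed
qed

context
  fixes M :: "'w measure" and B :: "real \<Rightarrow> 'w \<Rightarrow> real"
  assumes prob: "prob_space M" and gaussian: "gaussian_process_on M {0..1} B"
    and centred: "\<And>t. t \<in> {0..1} \<Longrightarrow> integral\<^sup>L M (B t) = 0"
begin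

lemma gaussian_process_component:
  assumes "t \<in> {0..1}"
  shows "gaussian_rv M (B t)"
proof -
  have "gaussian_rv M (\<lambda>\<omega>. \<Sum>s\<in>{t}. (\<lambda>_. 1) s * B s \<omega>)"
    using assms by (intro gaussian[unfolded gaussian_process_on_def, rule_format]) auto
  then show ?thesis by simp
qed

lemma linear_combination_moment:
  assumes "finite T" and "T \<subseteq> {0..1}" and "0 < k"
  shows "has_bochner_integral M (\<lambda>\<omega>. (\<Sum>t\<in>T. c t * B t \<omega>) ^ (2 * k))
    (fact (2 * k) / (2 ^ k * fact k) * (integral\<^sup>L M (\<lambda>\<omega>. (\<Sum>t\<in>T. c t * B t \<omega>)\<^sup>2)) ^ k)"
proof (rule centred_gaussian_even_moment[OF prob _ _ \<open>0 < k\<close>])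
  show "gaussian_rv M (\<lambda>\<omega>. \<Sum>t\<in>T. c t * B t \<omega>)"
    using gaussian assms by (simp add: gaussian_process_on_def)
  have "integrable M (B t)" if "t \<in> T" for t
    using that assms prob gaussian_process_component gaussian_rv_integrable by blast
  then show "integral\<^sup>L M (\<lambda>\<omega>. \<Sum>t\<in>T. c t * B t \<omega>) = 0"
    using centred assms by (subst Bochner_Integration.integral_sum) (auto simp: subset_eq)
qed

text \<open>Fatou's lemma along Gaussian approximations of \<open>X\<close>. Their second moments
  are bounded crudely by twice that of \<open>X\<close> plus a vanishing error; the resulting 2^k
  cancels the one in the Gaussian coefficient, which leaves (2k)!/k!.\<close>

lemma gaussian_space_moment:
  assumes X: "X \<in> gaussian_space M B" and k: "0 < k"
  shows "(\<integral>\<^sup>+\<omega>. ennreal (X \<omega> ^ (2 * k)) \<partial>M)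
    \<le> ennreal (fact (2 * k) / fact k * (integral\<^sup>L M (\<lambda>\<omega>. (X \<omega>)\<^sup>2)) ^ k)"
proof -
  define I where "I = integral\<^sup>L M (\<lambda>\<omega>. (X \<omega>)\<^sup>2)"
  have [measurable]: "X \<in> borel_measurable M" and X2: "integrable M (\<lambda>\<omega>. (X \<omega>)\<^sup>2)"
    using X by (simp_all add: gaussian_space_def L2_def)
  have approx: "\<forall>\<epsilon>>0. \<exists>T c. finite T \<and> T \<subseteq> {0..1} \<and>
        L2_norm M (\<lambda>\<omega>. X \<omega> - (\<Sum>t\<in>T. c t * B t \<omega>)) < \<epsilon>"
    using X by (simp add: gaussian_space_def)
  define Q where "Q n Z \<longleftrightarrow> Z \<in> borel_measurable M \<and> integrable M (\<lambda>\<omega>. (Z \<omega>)\<^sup>2) \<and>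
      has_bochner_integral M (\<lambda>\<omega>. Z \<omega> ^ (2 * k))
        (fact (2 * k) / (2 ^ k * fact k) * (integral\<^sup>L M (\<lambda>\<omega>. (Z \<omega>)\<^sup>2)) ^ k) \<and>
      L2_norm M (\<lambda>\<omega>. X \<omega> - Z \<omega>) < 1 / Suc n" for n Z
  have "\<exists>Z. Q n Z" for n
  proof -
    have "0 < 1 / real (Suc n)" by simp
    from approx[rule_format, OF this] obtain T c where T: "finite T" "T \<subseteq> {0..1}"
      and *: "L2_norm M (\<lambda>\<omega>. X \<omega> - (\<Sum>t\<in>T. c t * B t \<omega>)) < 1 / Suc n"
      by (elim exE conjE)
    have "(\<lambda>\<omega>. \<Sum>t\<in>T. c t * B t \<omega>) \<in> borel_measurable M"
      using gaussian T by (auto simp: gaussian_process_on_def intro!: gaussian_rv_measurable)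
    then show ?thesis unfolding Q_def
      using * linear_combination_moment[OF T k, of c]
        integrable.intros[OF linear_combination_moment[OF T, of 1 c]]
      by (intro exI[of _ "\<lambda>\<omega>. \<Sum>t\<in>T. c t * B t \<omega>"]) auto
  qed
  then obtain Z where Z: "\<And>n. Q n (Z n)" by metis
  have Zm [measurable]: "Z n \<in> borel_measurable M"
    and Z2: "integrable M (\<lambda>\<omega>. (Z n \<omega>)\<^sup>2)"
    and Zk: "has_bochner_integral M (\<lambda>\<omega>. Z n \<omega> ^ (2 * k))
        (fact (2 * k) / (2 ^ k * fact k) * (integral\<^sup>L M (\<lambda>\<omega>. (Z n \<omega>)\<^sup>2)) ^ k)"
    and ZX: "L2_norm M (\<lambda>\<omega>. X \<omega> - Z n \<omega>) < 1 / Suc n" for n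
    using Z[of n] by (simp_all only: Q_def)
  have diff2: "integrable M (\<lambda>\<omega>. (X \<omega> - Z n \<omega>)\<^sup>2)" for n
  proof (rule Bochner_Integration.integrable_bound)
    show "integrable M (\<lambda>\<omega>. 2 * (X \<omega>)\<^sup>2 + 2 * (Z n \<omega>)\<^sup>2)" using X2 Z2 by simp
    have "(x - z)\<^sup>2 \<le> 2 * x\<^sup>2 + 2 * z\<^sup>2" for x z :: real
      using zero_le_power2[of "x + z"] by (simp add: power2_sum power2_diff)
    then show "AE \<omega> in M. norm ((X \<omega> - Z n \<omega>)\<^sup>2) \<le> norm (2 * (X \<omega>)\<^sup>2 + 2 * (Z n \<omega>)\<^sup>2)"
      by (intro AE_I2) simp
  qed measurable
  have diff_le: "integral\<^sup>L M (\<lambda>\<omega>. (X \<omega> - Z n \<omega>)\<^sup>2) \<le> 1 / Suc n" for n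
  proof -
    have "integral\<^sup>L M (\<lambda>\<omega>. (X \<omega> - Z n \<omega>)\<^sup>2) = (L2_norm M (\<lambda>\<omega>. X \<omega> - Z n \<omega>))\<^sup>2"
      by (simp add: L2_norm_def)
    also have "\<dots> \<le> (1 / Suc n)\<^sup>2"
      using ZX[of n] by (intro power_mono) (auto simp: L2_norm_def)
    also have "\<dots> \<le> 1 / Suc n" by (simp add: power2_eq_square divide_simps)
    finally show ?thesis .
  qed
  \<comment> \<open>The squared differences tend to 0 in L^1, hence almost everywhere along a
    subsequence.\<close>
  have "(\<lambda>n. integral\<^sup>L M (\<lambda>\<omega>. norm ((X \<omega> - Z n \<omega>)\<^sup>2))) \<longlonglongrightarrow> 0"
    by (rule tendsto_sandwich[OF _ _ tendsto_const LIMSEQ_inverse_real_of_nat]) (use diff_le in \<open>auto simp: inverse_eq_divide\<close>)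
  from tendsto_L1_AE_subseq[OF diff2 this]
  obtain r where r: "strict_mono r" and ae: "AE \<omega> in M. (\<lambda>n. (X \<omega> - Z (r n) \<omega>)\<^sup>2) \<longlonglongrightarrow> 0"
    by blast
  define u where "u = (\<lambda>n. fact (2 * k) / (2 ^ k * fact k) * (2 * I + 2 / real (Suc n)) ^ k)"
  have moment: "(\<integral>\<^sup>+\<omega>. ennreal (Z n \<omega> ^ (2 * k)) \<partial>M) \<le> ennreal (u n)" for n
  proof -
    have "integral\<^sup>L M (\<lambda>\<omega>. (Z n \<omega>)\<^sup>2) \<le> integral\<^sup>L M (\<lambda>\<omega>. 2 * (X \<omega>)\<^sup>2 + 2 * (X \<omega> - Z n \<omega>)\<^sup>2)"
    proof (rule integral_mono)
      have "z\<^sup>2 \<le> 2 * x\<^sup>2 + 2 * (x - z)\<^sup>2" for x z :: real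
        using zero_le_power2[of "2 * x - z"] by (simp add: power2_diff power_mult_distrib)
      then show "(Z n \<omega>)\<^sup>2 \<le> 2 * (X \<omega>)\<^sup>2 + 2 * (X \<omega> - Z n \<omega>)\<^sup>2" for \<omega> .
    qed (use Z2 X2 diff2 in auto)
    also have "\<dots> \<le> 2 * I + 2 / Suc n" using X2 diff2 diff_le[of n] by (simp add: I_def)
    finally have le: "integral\<^sup>L M (\<lambda>\<omega>. (Z n \<omega>)\<^sup>2) \<le> 2 * I + 2 / Suc n" .
    have "(\<integral>\<^sup>+\<omega>. ennreal (Z n \<omega> ^ (2 * k)) \<partial>M)
        = ennreal (fact (2 * k) / (2 ^ k * fact k) * (integral\<^sup>L M (\<lambda>\<omega>. (Z n \<omega>)\<^sup>2)) ^ k)"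
      using Zk[of n] by (subst nn_integral_eq_integral) (auto simp: has_bochner_integral_iff)
    also have "\<dots> \<le> ennreal (u n)" unfolding u_def
      by (intro ennreal_leI mult_left_mono power_mono le) auto
    finally show ?thesis .
  qed
  have "AE \<omega> in M. ennreal (X \<omega> ^ (2 * k)) = liminf (\<lambda>n. ennreal (Z (r n) \<omega> ^ (2 * k)))"
    using ae
  proof eventually_elim
    case (elim \<omega>)
    then have "(\<lambda>n. sqrt ((X \<omega> - Z (r n) \<omega>)\<^sup>2)) \<longlonglongrightarrow> sqrt 0" by (rule tendsto_real_sqrt)
    then have "(\<lambda>n. X \<omega> - Z (r n) \<omega>) \<longlonglongrightarrow> 0" by (simp add: tendsto_rabs_zero_iff)
    then have "(\<lambda>n. X \<omega> - (X \<omega> - Z (r n) \<omega>)) \<longlonglongrightarrow> X \<omega> - 0" by (intro tendsto_intros)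
    then have "(\<lambda>n. ennreal (Z (r n) \<omega> ^ (2 * k))) \<longlonglongrightarrow> ennreal (X \<omega> ^ (2 * k))"
      by (intro tendsto_ennrealI tendsto_intros) simp
    then show ?case by (intro lim_imp_Liminf[symmetric]) auto
  qed
  then have "(\<integral>\<^sup>+\<omega>. ennreal (X \<omega> ^ (2 * k)) \<partial>M)
      = (\<integral>\<^sup>+\<omega>. liminf (\<lambda>n. ennreal (Z (r n) \<omega> ^ (2 * k))) \<partial>M)"
    by (rule nn_integral_cong_AE)
  also have "\<dots> \<le> liminf (\<lambda>n. \<integral>\<^sup>+\<omega>. ennreal (Z (r n) \<omega> ^ (2 * k)) \<partial>M)"
    by (rule nn_integral_liminf) measurable
  also have "\<dots> \<le> liminf (\<lambda>n. ennreal (u (r n)))"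
    by (intro Liminf_mono always_eventually allI moment)
  also have "\<dots> = ennreal (fact (2 * k) / (2 ^ k * fact k) * (2 * I + 0) ^ k)"
  proof (rule lim_imp_Liminf)
    have "(\<lambda>n. 2 * inverse (real (Suc n))) \<longlonglongrightarrow> 2 * 0"
      by (intro tendsto_mult tendsto_const LIMSEQ_inverse_real_of_nat)
    then have "u \<longlonglongrightarrow> fact (2 * k) / (2 ^ k * fact k) * (2 * I + 0) ^ k"
      unfolding u_def by (intro tendsto_intros) (simp add: divide_inverse)
    from LIMSEQ_subseq_LIMSEQ[OF this r]
    show "(\<lambda>n. ennreal (u (r n))) \<longlonglongrightarrow> ennreal (fact (2 * k) / (2 ^ k * fact k) * (2 * I + 0) ^ k)"
      by (intro tendsto_ennrealI) (simp add: o_def)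
  qed simp
  also have "fact (2 * k) / (2 ^ k * fact k) * (2 * I + 0) ^ k = fact (2 * k) / fact k * I ^ k"
  proof -
    have "a / (2 ^ k * b) * (2 * I + 0) ^ k = a / b * I ^ k" for a b :: real
      by (simp add: power_mult_distrib)
    then show ?thesis .
  qed
  finally show ?thesis by (simp add: I_def)
qed

end

section \<open>Remainders of the random series\<close>

text \<open>A pathwise formula in the chosen representatives, so that it is exactly linear in the
  increments appearing in the theorem. It agrees with the Wiener integral of the Fourier remainder
  only almost surely, for each fixed \<open>N\<close> and \<open>v\<close>.\<close>

definition series_rem ::
    "(nat \<Rightarrow> 'h::real_inner) \<Rightarrow> ('h \<Rightarrow> 'w \<Rightarrow> real) \<Rightarrow> nat \<Rightarrow> 'h \<Rightarrow> 'w \<Rightarrow> real" where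
  "series_rem \<phi> W N v \<omega> = W v \<omega> - (\<Sum>n = 1..N. inner (\<phi> n) v * W (\<phi> n) \<omega>)"

lemma wiener_linear:
  assumes "is_wiener_integral M B \<iota> W"
  shows "AE \<omega> in M. W (a *\<^sub>R \<eta> + b *\<^sub>R \<psi>) \<omega> = a * W \<eta> \<omega> + b * W \<psi> \<omega>"
  using assms[unfolded is_wiener_integral_def, THEN conjunct2, THEN conjunct2, THEN conjunct1]
  by (elim allE)

lemma wiener_diff:
  assumes "is_wiener_integral M B \<iota> W"
  shows "AE \<omega> in M. W (\<eta> - \<psi>) \<omega> = W \<eta> \<omega> - W \<psi> \<omega>"
  using wiener_linear[OF assms, of 1 \<eta> "-1" \<psi>] by simp

context
  fixes M :: "'w measure" and B :: "real \<Rightarrow> 'w \<Rightarrow> real"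
    and \<iota> :: "(real \<Rightarrow> real) \<Rightarrow> 'h::{real_inner, complete_space}"
    and W :: "'h \<Rightarrow> 'w \<Rightarrow> real" and \<phi> :: "nat \<Rightarrow> 'h"
  assumes prob: "prob_space M" and gaussian: "gaussian_process_on M {0..1} B"
    and centred: "\<And>t. t \<in> {0..1} \<Longrightarrow> integral\<^sup>L M (B t) = 0"
    and wiener: "is_wiener_integral M B \<iota> W"
    and basis: "is_orthonormal_basis \<phi>"
begin

lemma wiener_mem: "W \<psi> \<in> gaussian_space M B"
  using wiener by (simp add: is_wiener_integral_def)

lemma wiener_measurable [measurable]: "W \<psi> \<in> borel_measurable M"
  using wiener_mem[of \<psi>] by (simp add: gaussian_space_def L2_def)

lemma series_rem_measurable [measurable]: "series_rem \<phi> W N v \<in> borel_measurable M"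
  unfolding series_rem_def by measurable

lemma wiener_moment:
  assumes "0 < m"
  shows "(\<integral>\<^sup>+\<omega>. ennreal (\<bar>W \<psi> \<omega>\<bar> ^ (2 * m)) \<partial>M)
    \<le> ennreal (fact (2 * m) / fact m * ((norm \<psi>)\<^sup>2) ^ m)"
proof -
  have "L2_norm M (W \<psi>) = norm \<psi>"
    using wiener[unfolded is_wiener_integral_def, THEN conjunct2, THEN conjunct2, THEN conjunct2, THEN conjunct1]
    by (elim allE)
  then have "(sqrt (integral\<^sup>L M (\<lambda>\<omega>. (W \<psi> \<omega>)\<^sup>2)))\<^sup>2 = (norm \<psi>)\<^sup>2"
    by (simp add: L2_norm_def)
  then have "integral\<^sup>L M (\<lambda>\<omega>. (W \<psi> \<omega>)\<^sup>2) = (norm \<psi>)\<^sup>2" by simp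
  then show ?thesis
    using gaussian_space_moment[OF prob gaussian centred wiener_mem assms, of \<psi>]
    by (simp only: power_even_abs dvd_triv_left)
qed

lemma series_rem_eq_wiener: "AE \<omega> in M. series_rem \<phi> W N v \<omega> = W (fourier_rem \<phi> N v) \<omega>"
proof (induction N)
  case 0
  then show ?case by (simp add: series_rem_def fourier_rem_def)
next
  case (Suc N)
  have "fourier_rem \<phi> (Suc N) v = 1 *\<^sub>R fourier_rem \<phi> N v + (- inner (\<phi> (Suc N)) v) *\<^sub>R \<phi> (Suc N)"
    by (simp add: fourier_rem_def)
  then have "AE \<omega> in M. W (fourier_rem \<phi> (Suc N) v) \<omega>
      = 1 * W (fourier_rem \<phi> N v) \<omega> + (- inner (\<phi> (Suc N)) v) * W (\<phi> (Suc N)) \<omega>"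
    by (simp only: wiener_linear[OF wiener])
  with Suc show ?case by eventually_elim (simp add: series_rem_def)
qed

lemma series_rem_moment:
  assumes "0 < m"
  shows "(\<integral>\<^sup>+\<omega>. ennreal (\<bar>series_rem \<phi> W N v \<omega>\<bar> ^ (2 * m)) \<partial>M)
    \<le> ennreal (fact (2 * m) / fact m * ((norm (fourier_rem \<phi> N v))\<^sup>2) ^ m)"
proof -
  have "(\<integral>\<^sup>+\<omega>. ennreal (\<bar>series_rem \<phi> W N v \<omega>\<bar> ^ (2 * m)) \<partial>M)
      = (\<integral>\<^sup>+\<omega>. ennreal (\<bar>W (fourier_rem \<phi> N v) \<omega>\<bar> ^ (2 * m)) \<partial>M)"
    using series_rem_eq_wiener[of N v] by (intro nn_integral_cong_AE) (auto elim!: eventually_mono)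
  then show ?thesis using wiener_moment[OF assms] by simp
qed

lemma series_rem_diff_moment:
  assumes "0 < m" and "i \<le> j"
  shows "(\<integral>\<^sup>+\<omega>. ennreal (\<bar>series_rem \<phi> W j v \<omega> - series_rem \<phi> W i v \<omega>\<bar> ^ (2 * m)) \<partial>M)
    \<le> ennreal (fact (2 * m) / fact m * (fourier_mass \<phi> v j - fourier_mass \<phi> v i) ^ m)"
proof -
  have "AE \<omega> in M. series_rem \<phi> W j v \<omega> - series_rem \<phi> W i v \<omega>
      = W (fourier_rem \<phi> j v - fourier_rem \<phi> i v) \<omega>"
    using series_rem_eq_wiener[of i v] series_rem_eq_wiener[of j v]
      wiener_diff[OF wiener, of "fourier_rem \<phi> j v" "fourier_rem \<phi> i v"]
    by eventually_elim simp
  then have "(\<integral>\<^sup>+\<omega>. ennreal (\<bar>series_rem \<phi> W j v \<omega> - series_rem \<phi> W i v \<omega>\<bar> ^ (2 * m)) \<partial>M)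
      = (\<integral>\<^sup>+\<omega>. ennreal (\<bar>W (fourier_rem \<phi> j v - fourier_rem \<phi> i v) \<omega>\<bar> ^ (2 * m)) \<partial>M)"
    by (intro nn_integral_cong_AE) (auto elim!: eventually_mono)
  also have "\<dots> \<le> ennreal (fact (2 * m) / fact m * ((norm (fourier_rem \<phi> j v - fourier_rem \<phi> i v))\<^sup>2) ^ m)"
    by (rule wiener_moment[OF assms(1)])
  finally show ?thesis by (simp only: norm_fourier_rem_diff[OF basis assms(2)])
qed

text \<open>From \<open>N\<close> on, compare with the value at \<open>N\<close>: the maximal
  inequality bounds the differences, because by Pythagoras the mass gained after \<open>N\<close> is
  at most the squared norm of the remainder at \<open>N\<close>. What matters later is that
  \<open>K\<close> depends on neither \<open>N\<close> nor \<open>v\<close>.\<close>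

lemma sup_series_rem_moment:
  assumes m: "2 \<le> m"
  obtains K where "0 \<le> K" and "\<And>N v.
    (\<integral>\<^sup>+\<omega>. (SUP k\<in>{N..}. ennreal (\<bar>series_rem \<phi> W k v \<omega>\<bar> ^ (2 * m))) \<partial>M)
      \<le> ennreal (K * ((norm (fourier_rem \<phi> N v))\<^sup>2) ^ m)"
proof -
  define p where "p = 2 * m"
  define c where "c = (fact (2 * m) / fact m :: real)"
  have p: "0 < p" and m0: "0 < m" and c: "0 \<le> c" using m by (auto simp: p_def c_def)
  obtain C where C0: "0 \<le> C"
    and C: "\<And>a b::real. 0 \<le> a \<Longrightarrow> 0 \<le> b \<Longrightarrow> (a + b) ^ p \<le> 3 / 2 * a ^ p + C * b ^ p"
    using add_power_le[of "3 / 2" p] by auto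
  define K where "K = 3 / 2 * (4 * C * c) + C * c"
  show thesis
  proof (rule that)
    show "0 \<le> K" using C0 c by (simp add: K_def)
    fix N v
    define R where "R = (norm (fourier_rem \<phi> N v))\<^sup>2"
    define Y where "Y = (\<lambda>k. series_rem \<phi> W k v)"
    have [measurable]: "Y k \<in> borel_measurable M" for k by (simp add: Y_def)
    define D where "D = (\<lambda>j \<omega>. SUP k\<in>{N..j}. ennreal (\<bar>Y k \<omega> - Y N \<omega>\<bar> ^ p))"
    have [measurable]: "D j \<in> borel_measurable M" for j unfolding D_def by measurable
    have "(\<integral>\<^sup>+\<omega>. D j \<omega> \<partial>M) \<le> ennreal (4 * C * c * R ^ m)" for j
    proof (cases "N \<le> j")
      case True
      have "(\<integral>\<^sup>+\<omega>. D j \<omega> \<partial>M)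
          \<le> ennreal (4 * C * c * (fourier_mass \<phi> v j - fourier_mass \<phi> v N) ^ m)"
        unfolding D_def
      proof (rule maximal_moment_inequality[OF m c C0 mono_fourier_mass _ C _ True p])
        show "(\<integral>\<^sup>+\<omega>. ennreal (\<bar>Y j \<omega> - Y i \<omega>\<bar> ^ p) \<partial>M)
            \<le> ennreal (c * (fourier_mass \<phi> v j - fourier_mass \<phi> v i) ^ m)" if "i \<le> j" for i j
          using series_rem_diff_moment[OF m0 that, of v] unfolding Y_def p_def c_def .
      qed auto
      also have "\<dots> \<le> ennreal (4 * C * c * R ^ m)"
      proof (intro ennreal_leI mult_left_mono power_mono)
        have "0 \<le> (norm (fourier_rem \<phi> j v))\<^sup>2" by simp
        then show "fourier_mass \<phi> v j - fourier_mass \<phi> v N \<le> R"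
          unfolding R_def norm_fourier_rem[OF basis] by linarith
        show "0 \<le> fourier_mass \<phi> v j - fourier_mass \<phi> v N"
          using monoD[OF mono_fourier_mass True, of \<phi> v] by simp
      qed (use C0 c in simp)
      finally show ?thesis .
    \<comment> \<open>For \<open>j < N\<close> the index range is empty and its supremum is
      0.\<close>
    qed (simp add: D_def bot_ennreal)
    then have "(SUP j. \<integral>\<^sup>+\<omega>. D j \<omega> \<partial>M) \<le> ennreal (4 * C * c * R ^ m)"
      by (intro SUP_least)
    \<comment> \<open>Monotone convergence passes from finite index ranges to the infinite one at no
      cost in the constant.\<close>
    moreover have "(\<integral>\<^sup>+\<omega>. (SUP j. D j \<omega>) \<partial>M) = (SUP j. \<integral>\<^sup>+\<omega>. D j \<omega> \<partial>M)"
      by (rule nn_integral_monotone_convergence_SUP)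
        (auto simp: incseq_def le_fun_def D_def intro!: SUP_subset_mono)
    ultimately have sup: "(\<integral>\<^sup>+\<omega>. (SUP j. D j \<omega>) \<partial>M) \<le> ennreal (4 * C * c * R ^ m)" by simp
    have base: "(\<integral>\<^sup>+\<omega>. ennreal (\<bar>Y N \<omega>\<bar> ^ p) \<partial>M) \<le> ennreal (c * R ^ m)"
      using series_rem_moment[OF m0, of N v] unfolding Y_def p_def c_def R_def .
    have "(SUP k\<in>{N..}. ennreal (\<bar>Y k \<omega>\<bar> ^ p))
        \<le> ennreal (3 / 2) * (SUP j. D j \<omega>) + ennreal C * ennreal (\<bar>Y N \<omega>\<bar> ^ p)" for \<omega>
    proof (rule SUP_least)
      fix k assume k: "k \<in> {N..}"
      have "\<bar>Y k \<omega>\<bar> ^ p \<le> (\<bar>Y k \<omega> - Y N \<omega>\<bar> + \<bar>Y N \<omega>\<bar>) ^ p" by (intro power_mono) auto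
      also have "\<dots> \<le> 3 / 2 * \<bar>Y k \<omega> - Y N \<omega>\<bar> ^ p + C * \<bar>Y N \<omega>\<bar> ^ p" by (intro C) auto
      finally have "ennreal (\<bar>Y k \<omega>\<bar> ^ p)
          \<le> ennreal (3 / 2 * \<bar>Y k \<omega> - Y N \<omega>\<bar> ^ p + C * \<bar>Y N \<omega>\<bar> ^ p)"
        by (rule ennreal_leI)
      also have "\<dots> = ennreal (3 / 2) * ennreal (\<bar>Y k \<omega> - Y N \<omega>\<bar> ^ p) + ennreal C * ennreal (\<bar>Y N \<omega>\<bar> ^ p)"
        using C0 by (intro ennreal_linear_combination) auto
      also have "ennreal (\<bar>Y k \<omega> - Y N \<omega>\<bar> ^ p) \<le> (SUP j. D j \<omega>)"
        unfolding D_def using k by (intro SUP_upper2[of k] SUP_upper) auto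
      finally show "ennreal (\<bar>Y k \<omega>\<bar> ^ p)
          \<le> ennreal (3 / 2) * (SUP j. D j \<omega>) + ennreal C * ennreal (\<bar>Y N \<omega>\<bar> ^ p)"
        by (simp add: add_right_mono mult_left_mono)
    qed
    then have "(\<integral>\<^sup>+\<omega>. (SUP k\<in>{N..}. ennreal (\<bar>Y k \<omega>\<bar> ^ p)) \<partial>M)
        \<le> (\<integral>\<^sup>+\<omega>. ennreal (3 / 2) * (SUP j. D j \<omega>) + ennreal C * ennreal (\<bar>Y N \<omega>\<bar> ^ p) \<partial>M)"
      by (rule nn_integral_mono)
    also have "\<dots> = ennreal (3 / 2) * (\<integral>\<^sup>+\<omega>. (SUP j. D j \<omega>) \<partial>M)
        + ennreal C * (\<integral>\<^sup>+\<omega>. ennreal (\<bar>Y N \<omega>\<bar> ^ p) \<partial>M)"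
      by (subst nn_integral_add) (auto simp: nn_integral_cmult)
    also have "\<dots> \<le> ennreal (3 / 2) * ennreal (4 * C * c * R ^ m) + ennreal C * ennreal (c * R ^ m)"
      using sup base by (intro add_mono mult_left_mono) auto
    also have "\<dots> = ennreal (3 / 2 * (4 * C * c * R ^ m) + C * (c * R ^ m))"
      using C0 c by (intro ennreal_linear_combination[symmetric]) (auto simp: R_def)
    also have "3 / 2 * (4 * C * c * R ^ m) + C * (c * R ^ m) = K * R ^ m"
      by (simp add: K_def algebra_simps)
    finally show "(\<integral>\<^sup>+\<omega>. (SUP k\<in>{N..}. ennreal (\<bar>series_rem \<phi> W k v \<omega>\<bar> ^ (2 * m))) \<partial>M)
        \<le> ennreal (K * ((norm (fourier_rem \<phi> N v))\<^sup>2) ^ m)"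
      unfolding Y_def p_def R_def .
  qed
qed

lemma series_rem_dyadic_convergence:
  fixes v :: "nat \<Rightarrow> nat \<Rightarrow> 'h"
  assumes \<gamma>: "\<gamma> < H" and D: "0 \<le> D"
    and v: "\<And>l k. k < 2 ^ l \<Longrightarrow> (norm (v l k))\<^sup>2 \<le> D * (1 / 2 ^ l) powr (2 * H)"
  shows "AE \<omega> in M. \<forall>\<epsilon>>0. \<exists>N. \<forall>j\<ge>N. \<forall>l. \<forall>k<2 ^ l.
    2 powr (\<gamma> * l) * \<bar>series_rem \<phi> W j (v l k) \<omega>\<bar> \<le> \<epsilon>"
proof -
  \<comment> \<open>Summability over the levels asks for 2 m (H - \<gamma>) > 1, which this choice
    exceeds; the maximum with 2 serves the bisection.\<close>
  obtain m0 where m0: "1 / (H - \<gamma>) < real m0" using reals_Archimedean2 by blast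
  define m where "m = max 2 m0"
  have m: "2 \<le> m" "1 / (H - \<gamma>) < real m" using m0 by (auto simp: m_def)
  define p where "p = 2 * m"
  obtain K where K: "0 \<le> K" and moment: "\<And>N v.
    (\<integral>\<^sup>+\<omega>. (SUP k\<in>{N..}. ennreal (\<bar>series_rem \<phi> W k v \<omega>\<bar> ^ p)) \<partial>M)
      \<le> ennreal (K * ((norm (fourier_rem \<phi> N v))\<^sup>2) ^ m)"
    using sup_series_rem_moment[OF m(1)] unfolding p_def by blast
  define w where "w = (\<lambda>l. (2 powr (\<gamma> * real l)) ^ p)"
  have w: "0 \<le> w l" for l by (simp add: w_def)
  define U where "U = (\<lambda>N l k \<omega>. SUP j\<in>{N..}. ennreal (\<bar>series_rem \<phi> W j (v l k) \<omega>\<bar> ^ p))"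
  have [measurable]: "U N l k \<in> borel_measurable M" for N l k unfolding U_def by measurable
  define G where "G = (\<lambda>N \<omega>. \<Sum>l. \<Sum>k<2 ^ l. ennreal (w l) * U N l k \<omega>)"
  have [measurable]: "G N \<in> borel_measurable M" for N unfolding G_def by measurable
  define e where "e = (\<lambda>l N. \<Sum>k<2 ^ l. w l * (K * ((norm (fourier_rem \<phi> N (v l k)))\<^sup>2) ^ m))"
  \<comment> \<open>The ratio between consecutive levels: 1 counts the 2^l increments, 2 m \<gamma>
    comes from the weight and -2 m H from the squared norms to the power \<open>m\<close>.\<close>
  define \<rho> where "\<rho> = (2::real) powr (1 + 2 * real m * (\<gamma> - H))"
  have e0: "0 \<le> e l N" for l N unfolding e_def using w K by (intro sum_nonneg) auto
  have e_bound: "e l N \<le> K * D ^ m * \<rho> ^ l" for l N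
  proof -
    have "e l N \<le> (\<Sum>k<(2::nat) ^ l. w l * (K * (D * (1 / 2 ^ l) powr (2 * H)) ^ m))"
      unfolding e_def
    proof (intro sum_mono mult_left_mono power_mono)
      fix k assume "k \<in> {..<(2::nat) ^ l}"
      then have "(norm (v l k))\<^sup>2 \<le> D * (1 / 2 ^ l) powr (2 * H)" by (intro v) simp
      moreover have "(norm (fourier_rem \<phi> N (v l k)))\<^sup>2 \<le> (norm (v l k))\<^sup>2"
        by (intro power_mono norm_fourier_rem_le[OF basis]) simp
      ultimately show "(norm (fourier_rem \<phi> N (v l k)))\<^sup>2 \<le> D * (1 / 2 ^ l) powr (2 * H)" by linarith
    qed (use w K in auto)
    also have "\<dots> = K * D ^ m * (2 ^ l * w l * ((1 / 2 ^ l) powr (2 * H)) ^ m)"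
      by (simp add: power_mult_distrib mult_ac)
    also have "2 ^ l * w l * ((1 / 2 ^ l) powr (2 * H)) ^ m = \<rho> ^ l"
    proof -
      have a: "(2::real) ^ l = 2 powr real l" by (simp add: powr_realpow)
      have b: "w l = 2 powr (\<gamma> * real l * (2 * real m))"
        unfolding w_def p_def by (subst powr_power) (simp_all add: mult_ac)
      have "1 / (2::real) ^ l = 2 powr (- real l)" unfolding a powr_minus by (simp add: divide_inverse)
      then have c: "((1 / (2::real) ^ l) powr (2 * H)) ^ m = 2 powr (- real l * (2 * H) * real m)"
        by (simp only: powr_powr) (subst powr_power; simp add: mult_ac)
      have d: "\<rho> ^ l = 2 powr ((1 + 2 * real m * (\<gamma> - H)) * real l)"
        unfolding \<rho>_def by (subst powr_power) (simp_all add: mult_ac)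
      show ?thesis unfolding b c d unfolding a powr_add[symmetric]
        by (rule arg_cong[where f = "\<lambda>x. 2 powr x"]) (simp add: algebra_simps)
    qed
    finally show ?thesis .
  qed
  have "1 < real m * (H - \<gamma>)" using m \<gamma> by (simp add: field_simps)
  then have "1 + 2 * real m * (\<gamma> - H) < 0" by (simp add: algebra_simps)
  then have \<rho>: "0 < \<rho>" "\<rho> < 1" by (auto simp: \<rho>_def powr_less_one)
  \<comment> \<open>The majorant is free of \<open>N\<close> because the remainder maps are
    contractions; this permits exchanging the limit in \<open>N\<close> with the sum over
    levels.\<close>
  have dom: "summable (\<lambda>l. K * D ^ m * \<rho> ^ l)"
    using \<rho> by (intro summable_mult summable_geometric) simp
  have e_summable: "summable (\<lambda>l. e l N)" for N
    by (rule summable_comparison_test'[OF dom, of 0]) (use e0 e_bound in auto)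
  have e_lim: "(\<lambda>N. e l N) \<longlonglongrightarrow> 0" for l
  proof -
    have "(\<lambda>N. e l N) \<longlonglongrightarrow> (\<Sum>k<(2::nat) ^ l. w l * (K * ((0::real)\<^sup>2) ^ m))"
      unfolding e_def by (intro tendsto_intros fourier_rem_tendsto_0[OF basis])
    then show ?thesis using m by (simp add: zero_power)
  qed
  have "(\<lambda>N. \<Sum>l. e l N) \<longlonglongrightarrow> (\<Sum>l. 0)"
  proof (rule tannerys_theorem[THEN conjunct2, THEN conjunct2])
    show "\<forall>\<^sub>F (l, N) in at_top \<times>\<^sub>F sequentially. norm (e l N) \<le> K * D ^ m * \<rho> ^ l"
      using e0 e_bound by (intro always_eventually) auto
  qed (use e_lim dom in auto)
  then have e_sum_lim: "(\<lambda>N. ennreal (\<Sum>l. e l N)) \<longlonglongrightarrow> 0"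
    by (simp add: tendsto_ennreal_iff ennreal_0[symmetric] suminf_nonneg e0 e_summable del: ennreal_0)
  have G_le: "(\<integral>\<^sup>+\<omega>. G N \<omega> \<partial>M) \<le> ennreal (\<Sum>l. e l N)" for N
  proof -
    have "(\<integral>\<^sup>+\<omega>. G N \<omega> \<partial>M) = (\<Sum>l. \<Sum>k<2 ^ l. ennreal (w l) * (\<integral>\<^sup>+\<omega>. U N l k \<omega> \<partial>M))"
      unfolding G_def by (simp add: nn_integral_suminf nn_integral_sum nn_integral_cmult)
    also have "\<dots> \<le> (\<Sum>l. ennreal (e l N))"
    proof (rule suminf_le)
      fix l
      have "(\<Sum>k<2 ^ l. ennreal (w l) * (\<integral>\<^sup>+\<omega>. U N l k \<omega> \<partial>M))
          \<le> (\<Sum>k<2 ^ l. ennreal (w l) * ennreal (K * ((norm (fourier_rem \<phi> N (v l k)))\<^sup>2) ^ m))"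
        unfolding U_def by (intro sum_mono mult_left_mono moment) simp
      also have "\<dots> = ennreal (e l N)"
        unfolding e_def using w K by (simp add: ennreal_mult sum_nonneg flip: sum_ennreal)
      finally show "(\<Sum>k<2 ^ l. ennreal (w l) * (\<integral>\<^sup>+\<omega>. U N l k \<omega> \<partial>M)) \<le> ennreal (e l N)" .
    qed (auto intro: summableI)
    also have "\<dots> = ennreal (\<Sum>l. e l N)" using e0 e_summable by (intro suminf_ennreal2) auto
    finally show ?thesis .
  qed
  \<comment> \<open>\<open>G\<close> decreases in \<open>N\<close>, so a vanishing infimum already gives convergence for all larger indices.\<close>
  have "(\<integral>\<^sup>+\<omega>. (INF N. G N \<omega>) \<partial>M) \<le> 0"
  proof (rule LIMSEQ_le_const[OF e_sum_lim], intro exI allI impI)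
    fix N
    have "(\<integral>\<^sup>+\<omega>. (INF N. G N \<omega>) \<partial>M) \<le> (\<integral>\<^sup>+\<omega>. G N \<omega> \<partial>M)"
      by (intro nn_integral_mono INF_lower) simp
    then show "(\<integral>\<^sup>+\<omega>. (INF N. G N \<omega>) \<partial>M) \<le> ennreal (\<Sum>l. e l N)" using G_le[of N] by simp
  qed
  then have "AE \<omega> in M. (INF N. G N \<omega>) = 0"
    by (subst nn_integral_0_iff_AE[symmetric]) auto
  then show ?thesis
  proof eventually_elim
    case (elim \<omega>)
    show ?case
    proof (intro allI impI)
      fix \<epsilon> :: real assume \<epsilon>: "0 < \<epsilon>"
      then have "(INF N. G N \<omega>) < ennreal (\<epsilon> ^ p)" using elim by simp
      then obtain N where N: "G N \<omega> < ennreal (\<epsilon> ^ p)" by (auto simp: INF_less_iff)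
      \<comment> \<open>The supremum over later indices sits inside the sum, so a single summand of
        \<open>G N\<close> already dominates the \<open>p\<close>-th power of the weighted increment
        for all \<open>j\<close> from \<open>N\<close> on. One \<open>N\<close> serves all levels
        and positions.\<close>
      have "2 powr (\<gamma> * l) * \<bar>series_rem \<phi> W j (v l k) \<omega>\<bar> \<le> \<epsilon>" if "N \<le> j" "k < 2 ^ l" for j l k
      proof -
        have "ennreal ((2 powr (\<gamma> * l) * \<bar>series_rem \<phi> W j (v l k) \<omega>\<bar>) ^ p)
            = ennreal (w l) * ennreal (\<bar>series_rem \<phi> W j (v l k) \<omega>\<bar> ^ p)"
          by (simp add: w_def power_mult_distrib ennreal_mult)
        also have "\<dots> \<le> ennreal (w l) * U N l k \<omega>"
          unfolding U_def using that by (intro mult_left_mono SUP_upper) auto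
        also have "\<dots> \<le> (\<Sum>k<2 ^ l. ennreal (w l) * U N l k \<omega>)"
          using that by (intro member_le_sum) auto
        also have "\<dots> \<le> G N \<omega>"
        proof -
          have term_le: "f l \<le> suminf f" for f :: "nat \<Rightarrow> ennreal"
            using sum_le_suminf[of f "{l}"] by (simp add: summableI)
          show ?thesis unfolding G_def by (rule term_le)
        qed
        finally have "ennreal ((2 powr (\<gamma> * l) * \<bar>series_rem \<phi> W j (v l k) \<omega>\<bar>) ^ p) < ennreal (\<epsilon> ^ p)"
          using N by (rule le_less_trans)
        then have "(2 powr (\<gamma> * l) * \<bar>series_rem \<phi> W j (v l k) \<omega>\<bar>) ^ p < \<epsilon> ^ p"
          by (simp only: ennreal_less_iff zero_le_power mult_nonneg_nonneg abs_ge_zero powr_ge_zero)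
        then show ?thesis using \<epsilon> power_less_imp_less_base less_imp_le by blast
      qed
      then show "\<exists>N. \<forall>j\<ge>N. \<forall>l. \<forall>k<2 ^ l. 2 powr (\<gamma> * l) * \<bar>series_rem \<phi> W j (v l k) \<omega>\<bar> \<le> \<epsilon>"
        by (intro exI[of _ N]) simp
    qed
  qed
qed

end

section \<open>From dyadic increments and rational exponents to convergence of the paths\<close>

theorem corollary4p2:
  fixes \<alpha> \<beta> :: real
    and M :: "'w measure"
    and B :: "real \<Rightarrow> 'w \<Rightarrow> real"
    and \<iota> :: "(real \<Rightarrow> real) \<Rightarrow> 'h::{real_inner, complete_space}"
    and W :: "'h \<Rightarrow> 'w \<Rightarrow> real"
    and \<phi> :: "nat \<Rightarrow> 'h"
  assumes "0 < \<alpha>" and "\<alpha> < 1" and "0 < \<beta>" and "\<beta> \<le> 1" and "\<alpha> * \<beta> > 1 / 2"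
    and "bifractional_BM M \<alpha> \<beta> B"
    and "is_completion \<alpha> \<beta> \<iota>"
    and "is_wiener_integral M B \<iota> W"
    and "is_orthonormal_basis \<phi>"
  shows "AE \<omega> in M. \<forall>\<gamma>. 0 < \<gamma> \<and> \<gamma> < \<alpha> * \<beta> \<longrightarrow>
           holder_converges \<gamma>
             (\<lambda>N t. \<Sum>n = 1..N. inner (\<phi> n) (\<iota> (indicator {0..t})) * W (\<phi> n) \<omega>)
             (\<lambda>t. B t \<omega>)"
proof -
  define H where "H = \<alpha> * \<beta>"
  note BM = assms(6)[unfolded bifractional_BM_def]
  have prob: "prob_space M" and gaussian: "gaussian_process_on M {0..1} B"
    and centred: "\<And>t. t \<in> {0..1} \<Longrightarrow> integral\<^sup>L M (B t) = 0"
    and cont: "\<And>\<omega>. \<omega> \<in> space M \<Longrightarrow> continuous_on {0..1} (\<lambda>t. B t \<omega>)"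
    using BM by (simp_all only: Ball_def)
  note wiener = assms(8) and basis = assms(9)
  define h where "h = (\<lambda>t. \<iota> (indicator {0..t}))"
  define D where "D = 2 powr (1 - \<beta>)"
  have D: "0 \<le> D" by (simp add: D_def)
  have incr: "(norm (h t - h s))\<^sup>2 \<le> D * \<bar>t - s\<bar> powr (2 * H)" if "s \<in> {0..1}" "t \<in> {0..1}" for s t
    using norm_indicator_increment[OF assms(7,1,3,4) that] by (simp add: h_def D_def H_def mult.assoc)
  have W_h: "AE \<omega> in M. W (h t) \<omega> = B t \<omega>" if "t \<in> {0..1}" for t
    using wiener[unfolded is_wiener_integral_def, THEN conjunct2, THEN conjunct2, THEN conjunct2, THEN conjunct2] that
    unfolding h_def by (rule bspec)
  \<comment> \<open>The indicator of {0} is a null vector, so all partial sums vanish at 0.\<close>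
  have "inner (h 0) (h 0) = bifractional_cov \<alpha> \<beta> 0 0"
    unfolding h_def by (rule completion_inner[OF assms(7)]) auto
  then have h0: "h 0 = 0" by (simp add: bifractional_cov_def)
  define v where "v = (\<lambda>l k. h (real (Suc k) / 2 ^ l) - h (real k / 2 ^ l))"
  have dyadic_mem: "real k / 2 ^ l \<in> {0..1}" "real (Suc k) / 2 ^ l \<in> {0..1}" if "k < 2 ^ l" for k l :: nat
  proof -
    have "real (Suc k) \<le> real (2 ^ l)" using that by (simp only: of_nat_le_iff Suc_le_eq)
    then have "real (Suc k) \<le> 2 ^ l" by simp
    then have "real k \<le> 2 ^ l" by linarith
    with \<open>real (Suc k) \<le> 2 ^ l\<close> show "real k / 2 ^ l \<in> {0..1}" "real (Suc k) / 2 ^ l \<in> {0..1}"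
      by simp_all
  qed
  have v: "(norm (v l k))\<^sup>2 \<le> D * (1 / 2 ^ l) powr (2 * H)" if "k < 2 ^ l" for l k
  proof -
    have "\<bar>real (Suc k) / 2 ^ l - real k / 2 ^ l\<bar> = 1 / 2 ^ l" by (simp flip: diff_divide_distrib)
    then show ?thesis using incr[OF dyadic_mem[OF that]] by (simp add: v_def)
  qed
  \<comment> \<open>The exponent is quantified inside the almost sure statement; rational exponents
    keep the exceptional set null, and any \<gamma> below \<open>H\<close> has a rational above it
    that is still below \<open>H\<close>.\<close>
  have conv: "AE \<omega> in M. \<forall>q::rat. real_of_rat q < H \<longrightarrow> (\<forall>\<epsilon>>0. \<exists>N. \<forall>j\<ge>N. \<forall>l. \<forall>k<2 ^ l.
      2 powr (real_of_rat q * l) * \<bar>series_rem \<phi> W j (v l k) \<omega>\<bar> \<le> \<epsilon>)"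
    unfolding AE_all_countable
  proof
    fix q :: rat
    show "AE \<omega> in M. real_of_rat q < H \<longrightarrow> (\<forall>\<epsilon>>0. \<exists>N. \<forall>j\<ge>N. \<forall>l. \<forall>k<2 ^ l.
      2 powr (real_of_rat q * l) * \<bar>series_rem \<phi> W j (v l k) \<omega>\<bar> \<le> \<epsilon>)"
    proof (cases "real_of_rat q < H")
      case True
      have "AE \<omega> in M. \<forall>\<epsilon>>0. \<exists>N. \<forall>j\<ge>N. \<forall>l. \<forall>k<2 ^ l.
          2 powr (real_of_rat q * l) * \<bar>series_rem \<phi> W j (v l k) \<omega>\<bar> \<le> \<epsilon>"
        by (rule series_rem_dyadic_convergence[OF prob gaussian centred wiener basis True D v])
      then show ?thesis by (rule eventually_mono) (rule impI)
    qed simp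
  qed
  have W_v: "AE \<omega> in M. \<forall>l k. k < 2 ^ l \<longrightarrow>
      W (v l k) \<omega> = B (real (Suc k) / 2 ^ l) \<omega> - B (real k / 2 ^ l) \<omega>"
    unfolding AE_all_countable
  proof (intro allI)
    fix l k :: nat
    show "AE \<omega> in M. k < 2 ^ l \<longrightarrow>
        W (v l k) \<omega> = B (real (Suc k) / 2 ^ l) \<omega> - B (real k / 2 ^ l) \<omega>"
    proof (cases "k < 2 ^ l")
      case True
      from W_h[OF dyadic_mem(1)[OF True]] W_h[OF dyadic_mem(2)[OF True]]
        wiener_diff[OF wiener, of "h (real (Suc k) / 2 ^ l)" "h (real k / 2 ^ l)"]
      show ?thesis by eventually_elim (simp add: v_def)
    qed simp
  qed
  \<comment> \<open>The variance at 0 is zero, so the path starts at 0 only almost surely; this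
    matches the value of the partial sums there.\<close>
  have B0: "AE \<omega> in M. B 0 \<omega> = 0"
  proof -
    have "AE \<omega> in M. W (0::'h) \<omega> = 0"
      using wiener_diff[OF wiener, of 0 0] by simp
    moreover have "AE \<omega> in M. W (0::'h) \<omega> = B 0 \<omega>" using W_h[of 0] by (simp add: h0)
    ultimately show ?thesis by eventually_elim simp
  qed
  show ?thesis
    using conv W_v B0 AE_space
  proof eventually_elim
    case (elim \<omega>)
    define F where "F = (\<lambda>N t. \<Sum>n = 1..N. inner (\<phi> n) (h t) * W (\<phi> n) \<omega>)"
    have "holder_converges \<gamma> F (\<lambda>t. B t \<omega>)" if \<gamma>: "0 < \<gamma>" "\<gamma> < H" for \<gamma>
    proof (rule holder_converges_if_dyadic[OF \<gamma>(1)])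
      show "continuous_on {0..1} (\<lambda>t. B t \<omega>)" using cont elim by blast
      show "F N 0 = B 0 \<omega>" for N using elim by (simp add: F_def h0)
      show "F N \<in> holder_space \<gamma>" for N
      proof -
        \<comment> \<open>For fixed \<omega> a partial sum is the pairing of \<open>h t\<close> with
          a fixed vector, so Cauchy-Schwarz gives it the regularity of \<open>h\<close>; the
          exponent \<open>H\<close> drops to \<gamma> because distances are at most 1.\<close>
        define z where "z = (\<Sum>n = 1..N. W (\<phi> n) \<omega> *\<^sub>R \<phi> n)"
        have F_z: "F N t = inner z (h t)" for t
          by (simp add: F_def z_def inner_sum_left mult.commute)
        have bound: "\<bar>F N x - F N y\<bar> \<le> norm z * sqrt D * \<bar>x - y\<bar> powr \<gamma>"
          if xy: "x \<in> {0..1}" "y \<in> {0..1}" for x y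
        proof -
          have "norm (h x - h y) \<le> sqrt (D * \<bar>x - y\<bar> powr (2 * H))"
            using incr[OF xy(2,1)] by (rule real_le_rsqrt)
          also have "\<dots> = sqrt D * \<bar>x - y\<bar> powr H"
            by (simp add: real_sqrt_mult powr_half_sqrt[symmetric] powr_powr)
          also have "\<dots> \<le> sqrt D * \<bar>x - y\<bar> powr \<gamma>"
            using xy \<gamma> D by (intro mult_left_mono powr_mono') auto
          finally have "norm (h x - h y) \<le> sqrt D * \<bar>x - y\<bar> powr \<gamma>" .
          then have "norm z * norm (h x - h y) \<le> norm z * (sqrt D * \<bar>x - y\<bar> powr \<gamma>)"
            by (intro mult_left_mono) auto
          moreover have "\<bar>F N x - F N y\<bar> \<le> norm z * norm (h x - h y)"
            unfolding F_z inner_diff_right[symmetric] by (rule Cauchy_Schwarz_ineq2)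
          ultimately show ?thesis by (simp add: mult.assoc)
        qed
        have nonneg: "0 \<le> norm z * sqrt D" using D by simp
        have "F N 0 = 0" by (simp add: F_z h0)
        moreover have "continuous_on {0..1} (F N)"
          by (rule continuous_on_if_holder_bound[OF \<gamma>(1) nonneg bound])
        ultimately show ?thesis
          using holder_space_and_norm_bound(1)[OF _ _ nonneg \<gamma>(1) bound] by blast
      qed
      fix \<epsilon> :: real assume \<epsilon>: "0 < \<epsilon>"
      \<comment> \<open>Weights at the rational exponent dominate those at \<gamma>, as the levels
        are nonnegative.\<close>
      obtain q where q: "\<gamma> < real_of_rat q" "real_of_rat q < H" using of_rat_dense[OF \<gamma>(2)] by blast
      with elim(1) \<epsilon> obtain N where N: "\<And>j l k. N \<le> j \<Longrightarrow> k < 2 ^ l \<Longrightarrow>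
          2 powr (real_of_rat q * real l) * \<bar>series_rem \<phi> W j (v l k) \<omega>\<bar> \<le> \<epsilon>"
        by blast
      have "2 powr (\<gamma> * l) * \<bar>(F j (real (Suc k) / 2 ^ l) - B (real (Suc k) / 2 ^ l) \<omega>)
        - (F j (real k / 2 ^ l) - B (real k / 2 ^ l) \<omega>)\<bar> \<le> \<epsilon>" if jk: "N \<le> j" "k < 2 ^ l" for j l k
      proof -
        have "F j (real (Suc k) / 2 ^ l) - F j (real k / 2 ^ l) = (\<Sum>n = 1..j. inner (\<phi> n) (v l k) * W (\<phi> n) \<omega>)"
          unfolding F_def v_def inner_diff_right left_diff_distrib sum_subtractf ..
        then have "(F j (real (Suc k) / 2 ^ l) - B (real (Suc k) / 2 ^ l) \<omega>)
            - (F j (real k / 2 ^ l) - B (real k / 2 ^ l) \<omega>) = - series_rem \<phi> W j (v l k) \<omega>"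
          using elim(2) jk(2) unfolding series_rem_def by simp
        then have "2 powr (\<gamma> * l) * \<bar>(F j (real (Suc k) / 2 ^ l) - B (real (Suc k) / 2 ^ l) \<omega>)
            - (F j (real k / 2 ^ l) - B (real k / 2 ^ l) \<omega>)\<bar>
            = 2 powr (\<gamma> * l) * \<bar>series_rem \<phi> W j (v l k) \<omega>\<bar>" by (simp only: abs_minus_cancel)
        also have "\<dots> \<le> 2 powr (real_of_rat q * l) * \<bar>series_rem \<phi> W j (v l k) \<omega>\<bar>"
          using q by (intro mult_right_mono powr_mono) auto
        also have "\<dots> \<le> \<epsilon>" using N[OF jk] .
        finally show ?thesis .
      qed
      then show "\<exists>N. \<forall>j\<ge>N. \<forall>l. \<forall>k<2 ^ l.
        2 powr (\<gamma> * l) * \<bar>(F j (real (Suc k) / 2 ^ l) - B (real (Suc k) / 2 ^ l) \<omega>)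
          - (F j (real k / 2 ^ l) - B (real k / 2 ^ l) \<omega>)\<bar> \<le> \<epsilon>" by blast
    qed
    then show ?case by (simp add: F_def h_def H_def)
  qed
qed

end
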